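(* The number of queries required to decide the existence of a connected strongly-proportional allocation for $n$ agents, or to compute such an allocation if it exists, is in $\Theta(n\cdot 2^n)$, even for agents with equal entitlements.
   Context: The cake is $C=[0,1]$, to be divided among agents $[n]$. Each agent $i$ has a valuation function $V_i$ on the algebra generated by intervals of $C$ that is non-negative, finitely additive, normalized ($V_i(C)=1$), with $x\mapsto V_i([0,x])$ continuous (agents need not be hungry). Entitlements are $w_i>0$ with $\sum_i w_i=1$; equal entitlements means $w_i=1/n$. An allocation is a partition $C=X_1\sqcup\cdots\sqcup X_n$ into finite unions of closed intervals, pairwise disjoint except possibly at endpoints; it is connected if each $X_i$ is a single interval and strongly-proportional if $V_i(X_i)>w_i$ for all $i$. Algorithms access valuations only via queries (each counts as one): $\textsc{Eval}_i(x,y)=V_i([x,y])$; $\textsc{Mark}_i(x,r)$ returns the largest $z\in C$ with $V_i([x,z])=r$, or $\infty$ if $V_i([x,1])<r$.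
   Formalization: Valuations are additionally required to give the single point 0 value zero; continuity of V_i([0,x]) on [0,1] alone permits an atom at 0, for which Mark_i(0,r) with r below the atom's value would have no answer. *)

theory Defs
  imports "HOL-Analysis.Analysis" "HOL-Library.Landau_Symbols"
begin

text \<open>Agents are the indices \<open>i < n\<close>; data attached to larger indices is ignored.\<close>

definition cake :: "real set" where
  "cake = {0..1}"

definition interval_algebra :: "real set set" where
  "interval_algebra =
     \<Inter>{M. algebra cake M \<and> {I. is_interval I \<and> I \<subseteq> cake} \<subseteq> M}"

text \<open>Continuity of \<open>x \<mapsto> V [0,x]\<close> on the cake makes every point of \<open>(0,1]\<close> worthless, but does not
  exclude an atom at the left end. The condition \<open>V {0} = 0\<close> does; without it
  a mark with target below \<open>V {0}\<close> would not exist.\<close>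

definition valuation :: "(real set \<Rightarrow> real) \<Rightarrow> bool" where
  "valuation V \<longleftrightarrow>
     (\<forall>A\<in>interval_algebra. 0 \<le> V A) \<and>
     Measure_Space.additive interval_algebra V \<and>
     V cake = 1 \<and>
     continuous_on cake (\<lambda>x. V {0..x}) \<and>
     V {0} = 0"

definition profiles :: "nat \<Rightarrow> (nat \<Rightarrow> real set \<Rightarrow> real) set" where
  "profiles n = {V. \<forall>i<n. valuation (V i)}"

definition entitlements :: "nat \<Rightarrow> (nat \<Rightarrow> real) set" where
  "entitlements n = {w. (\<forall>i<n. 0 < w i) \<and> (\<Sum>i<n. w i) = 1}"

definition equal_entitlements :: "nat \<Rightarrow> nat \<Rightarrow> real" where
  "equal_entitlements n = (\<lambda>i. 1 / real n)"

definition allocation :: "nat \<Rightarrow> (nat \<Rightarrow> real set) \<Rightarrow> bool" where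
  "allocation n X \<longleftrightarrow>
     (\<forall>i<n. \<exists>F. finite F \<and> (\<forall>I\<in>F. \<exists>a b. a \<le> b \<and> I = {a..b}) \<and> X i = \<Union>F) \<and>
     (\<Union>i<n. X i) = cake \<and>
     (\<forall>i<n. \<forall>j<n. i \<noteq> j \<longrightarrow> X i \<inter> X j \<subseteq> frontier (X i) \<inter> frontier (X j))"

definition connected_allocation :: "nat \<Rightarrow> (nat \<Rightarrow> real set) \<Rightarrow> bool" where
  "connected_allocation n X \<longleftrightarrow> allocation n X \<and> (\<forall>i<n. is_interval (X i))"

definition strongly_proportional ::
  "nat \<Rightarrow> (nat \<Rightarrow> real) \<Rightarrow> (nat \<Rightarrow> real set \<Rightarrow> real) \<Rightarrow> (nat \<Rightarrow> real set) \<Rightarrow> bool" where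
  "strongly_proportional n w V X \<longleftrightarrow> (\<forall>i<n. V i (X i) > w i)"

definition csp ::
  "nat \<Rightarrow> (nat \<Rightarrow> real) \<Rightarrow> (nat \<Rightarrow> real set \<Rightarrow> real) \<Rightarrow> (nat \<Rightarrow> real set) \<Rightarrow> bool" where
  "csp n w V X \<longleftrightarrow> connected_allocation n X \<and> strongly_proportional n w V X"

text \<open>A deterministic adaptive algorithm is a well-founded decision tree: it either stops
  with an output or asks a query and continues depending on the answer. Only queries are
  counted; any other computation is free. For given \<open>n\<close> and entitlements there is one tree, so
  an algorithm knows these, but it sees the valuations only through the answers.\<close>

datatype query = Eval nat real real | Mark nat real real

datatype 'a protocol = Output 'a | Ask query "ereal \<Rightarrow> 'a protocol"

primrec answer :: "(nat \<Rightarrow> real set \<Rightarrow> real) \<Rightarrow> query \<Rightarrow> ereal" where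
  "answer V (Eval i x y) = ereal (V i {x..y})"
| "answer V (Mark i x r) =
     (if V i {x..1} < r then \<infinity> else ereal (GREATEST z. z \<in> cake \<and> V i {x..z} = r))"

primrec legal_query :: "nat \<Rightarrow> query \<Rightarrow> bool" where
  "legal_query n (Eval i x y) \<longleftrightarrow> i < n \<and> x \<in> cake \<and> y \<in> cake \<and> x \<le> y"
| "legal_query n (Mark i x r) \<longleftrightarrow> i < n \<and> x \<in> cake \<and> 0 \<le> r"

primrec legal :: "nat \<Rightarrow> 'a protocol \<Rightarrow> bool" where
  "legal n (Output a) \<longleftrightarrow> True"
| "legal n (Ask q k) \<longleftrightarrow> legal_query n q \<and> (\<forall>v. legal n (k v))"

primrec run :: "(nat \<Rightarrow> real set \<Rightarrow> real) \<Rightarrow> 'a protocol \<Rightarrow> 'a" where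
  "run V (Output a) = a"
| "run V (Ask q k) = run V (k (answer V q))"

primrec num_queries :: "(nat \<Rightarrow> real set \<Rightarrow> real) \<Rightarrow> 'a protocol \<Rightarrow> nat" where
  "num_queries V (Output a) = 0"
| "num_queries V (Ask q k) = Suc (num_queries V (k (answer V q)))"

text \<open>The worst-case number of queries, over the instances \<open>\<I>\<close>, of the best algorithm
  whose output is correct (relation \<open>R\<close>) on every instance in \<open>\<I>\<close>. It is \<open>\<infinity>\<close> if no
  algorithm has a uniform bound.\<close>

definition query_complexity ::
  "nat \<Rightarrow> (nat \<Rightarrow> real set \<Rightarrow> real) set \<Rightarrow> ((nat \<Rightarrow> real set \<Rightarrow> real) \<Rightarrow> 'a \<Rightarrow> bool) \<Rightarrow> enat" where
  "query_complexity n \<I> R =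
     (INF P \<in> {P. legal n P \<and> (\<forall>V\<in>\<I>. R V (run V P))}. SUP V\<in>\<I>. enat (num_queries V P))"

definition decide_queries :: "nat \<Rightarrow> (nat \<Rightarrow> real) \<Rightarrow> enat" where
  "decide_queries n w =
     query_complexity n (profiles n) (\<lambda>V b. b \<longleftrightarrow> (\<exists>X. csp n w V X))"

text \<open>Computing an allocation if it exists: the algorithm reports \<open>None\<close> if there is none.\<close>

definition compute_queries :: "nat \<Rightarrow> (nat \<Rightarrow> real) \<Rightarrow> enat" where
  "compute_queries n w =
     query_complexity n (profiles n)
       (\<lambda>V out. case out of Some X \<Rightarrow> csp n w V X | None \<Rightarrow> \<not> (\<exists>X. csp n w V X))"

text \<open>The promise version: behaviour on instances without such an allocation is irrelevant.\<close>

definition compute_promise_queries :: "nat \<Rightarrow> (nat \<Rightarrow> real) \<Rightarrow> enat" where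
  "compute_promise_queries n w =
     query_complexity n {V \<in> profiles n. \<exists>X. csp n w V X} (csp n w)"

definition has_order :: "(nat \<Rightarrow> enat) \<Rightarrow> (nat \<Rightarrow> real) \<Rightarrow> bool" where
  "has_order f g \<longleftrightarrow>
     (\<forall>\<^sub>F n in sequentially. f n \<noteq> \<infinity>) \<and> (\<lambda>n. real (the_enat (f n))) \<in> \<Theta>(g)"

end

theory Submission
  imports Defs "HOL-Library.Nat_Bijection"
begin

text \<open>
  Upper bound. Let \<open>B S\<close> be the minimum over \<open>i \<in> S\<close> of the mark of agent \<open>i\<close> with target \<open>w i\<close> started
  at \<open>B (S - {i})\<close>. Since marks are the largest possible points, \<open>[0, y]\<close> can be divided among \<open>S\<close>
  with everyone strictly satisfied iff \<open>y > B S\<close>, so an allocation exists iff \<open>B [n] < 1\<close>. Two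
  more queries per agent turn the infima into actual cuts.

  Lower bound, with equal entitlements. One instance without an allocation has cut points \<open>pt S\<close>,
  pairwise distinct for the sets \<open>S\<close> of the first \<open>n - 1\<close> agents, such that every agent \<open>i\<close> values the
  piece from \<open>pt S\<close> to \<open>pt (S \<union> {i})\<close> at exactly \<open>1 / n\<close>. Shifting a little value of one agent \<open>i\<close> to
  the left inside a small neighbourhood of a single point \<open>pt (S \<union> {i})\<close> creates an allocation. A query
  detects at most two of the \<open>(n - 1) 2 ^ (n - 2)\<close> shifts, namely those near the end points of the
  piece that it measures. A fixed allocation can exploit at most two shifts per agent, so a correct
  algorithm must detect nearly all of them, even if it only has to find an allocation that exists.
\<close>

section \<open>Valuations and connected allocations\<close>

lemma interval_in_algebra: "is_interval I \<Longrightarrow> I \<subseteq> cake \<Longrightarrow> I \<in> interval_algebra"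
  by (auto simp: interval_algebra_def)

lemma valuation_Un:
  assumes "valuation V" "is_interval I" "I \<subseteq> cake" "is_interval J" "J \<subseteq> cake" "I \<inter> J = {}"
  shows "V (I \<union> J) = V I + V J"
  using assms interval_in_algebra unfolding valuation_def Measure_Space.additive_def by blast

lemma valuation_nonneg: "valuation V \<Longrightarrow> is_interval I \<Longrightarrow> I \<subseteq> cake \<Longrightarrow> 0 \<le> V I"
  using interval_in_algebra unfolding valuation_def by blast

lemma valuation_empty: "valuation V \<Longrightarrow> V {} = 0"
  using valuation_Un[of V "{}" "{}"] by simp

text \<open>An atom at \<open>x > 0\<close> would make \<open>V {0..y}\<close> jump by
  \<open>V {x}\<close> as \<open>y\<close> reaches \<open>x\<close> from the left, against
  continuity. At \<open>0\<close> the definition excludes it.\<close>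

lemma valuation_point:
  assumes V: "valuation V" and x: "x \<in> cake"
  shows "V {x} = 0"
proof (rule ccontr)
  assume "V {x} \<noteq> 0"
  moreover have "0 \<le> V {x}"
    using V x by (intro valuation_nonneg) (auto simp: is_interval_def)
  ultimately have pos: "0 < V {x}" by simp
  have "x \<noteq> 0"
    using V \<open>V {x} \<noteq> 0\<close> unfolding valuation_def by metis
  then have x0: "0 < x" "x \<le> 1"
    using x by (auto simp: cake_def)
  have "continuous_on cake (\<lambda>x. V {0..x})"
    using V unfolding valuation_def by blast
  then obtain d where d: "0 < d" "\<And>y. y \<in> cake \<Longrightarrow> dist y x < d \<Longrightarrow> dist (V {0..y}) (V {0..x}) < V {x}"
    using x pos unfolding continuous_on_iff by metis
  define y where "y = max 0 (x - d / 2)"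
  have y: "0 \<le> y" "y < x" "dist y x < d"
    using x0 d(1) by (auto simp: y_def dist_real_def)
  have "{0..x} = {0..y} \<union> ({y<..<x} \<union> {x})"
    using y by auto
  also have "V \<dots> = V {0..y} + V ({y<..<x} \<union> {x})"
    using y x0 by (intro valuation_Un[OF V]) (auto simp: is_interval_def cake_def)
  also have "V ({y<..<x} \<union> {x}) = V {y<..<x} + V {x}"
    using y x0 by (intro valuation_Un[OF V]) (auto simp: is_interval_def cake_def)
  finally have "V {0..x} = V {0..y} + (V {y<..<x} + V {x})" .
  moreover have "0 \<le> V {y<..<x}"
    using y x0 by (intro valuation_nonneg[OF V]) (auto simp: cake_def is_interval_def)
  moreover have "dist (V {0..y}) (V {0..x}) < V {x}"
    using y x0 by (intro d) (auto simp: cake_def)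
  ultimately show False by (simp add: dist_real_def)
qed

lemma valuation_Icc:
  assumes V: "valuation V" and "0 \<le> x" "x \<le> y" "y \<le> 1"
  shows "V {x..y} = V {0..y} - V {0..x}"
proof -
  have "{0..y} = {0..x} \<union> {x<..y}" using assms by auto
  also have "V \<dots> = V {0..x} + V {x<..y}"
    using assms by (intro valuation_Un[OF V]) (auto simp: is_interval_def cake_def)
  finally have "V {0..y} = V {0..x} + V {x<..y}" .
  moreover have "{x..y} = {x} \<union> {x<..y}" using assms by auto
  moreover have "V ({x} \<union> {x<..y}) = V {x} + V {x<..y}"
    using assms by (intro valuation_Un[OF V]) (auto simp: is_interval_def cake_def)
  moreover have "V {x} = 0" using assms by (intro valuation_point) (auto simp: cake_def)
  ultimately show ?thesis by simp
qed

lemma valuation_cdf_mono: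
  assumes "valuation V" "0 \<le> x" "x \<le> y" "y \<le> 1"
  shows "V {0..x} \<le> V {0..y}"
  using valuation_Icc[OF assms] valuation_nonneg[OF assms(1), of "{x..y}"] assms
  by (auto simp: cake_def is_interval_cc)

section \<open>Ordered pieces, barriers and tilings\<close>

text \<open>Empty and one-point pieces are worth 0 and cannot exceed a positive entitlement. Overlap
  restricted to frontiers then forces the intervals into a left-to-right order.\<close>

lemma csp_intervals:
  assumes V: "V \<in> profiles n" and w: "\<And>i. i < n \<Longrightarrow> 0 < w i" and X: "csp n w V X"
  shows "\<exists>a b.
    (\<forall>i<n. X i = {a i..b i} \<and> 0 \<le> a i \<and> a i < b i \<and> b i \<le> 1 \<and> w i < V i {a i..b i}) \<and>
    (\<forall>i<n. \<forall>j<n. i \<noteq> j \<longrightarrow> a i \<le> a j \<longrightarrow> b i \<le> a j)"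
proof -
  have al: "allocation n X" and int: "\<And>i. i < n \<Longrightarrow> is_interval (X i)"
    and gt: "\<And>i. i < n \<Longrightarrow> w i < V i (X i)"
    using X by (auto simp: csp_def connected_allocation_def strongly_proportional_def)
  have val: "valuation (V i)" if "i < n" for i
    using V that by (auto simp: profiles_def)
  have "\<exists>a b. X i = {a..b} \<and> 0 \<le> a \<and> a < b \<and> b \<le> 1 \<and> w i < V i {a..b}" if i: "i < n" for i
  proof -
    obtain F where F: "finite F" "\<And>I. I \<in> F \<Longrightarrow> \<exists>a b. a \<le> b \<and> I = {a..b}" "X i = \<Union>F"
      using al i by (auto simp: allocation_def)
    have "compact I" if "I \<in> F" for I
      using F(2)[OF that] by (auto intro: compact_Icc)
    then have "compact (X i)"
      unfolding F(3) using F(1) by (intro compact_Union) auto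
    then obtain a b where ab: "X i = {a..b}"
      using connected_compact_interval_1[of "X i"] int[OF i]
      by (auto simp: is_interval_connected_1)
    have ne: "X i \<noteq> {}"
      using valuation_empty[OF val[OF i]] gt[OF i] w[OF i] by auto
    have sub: "X i \<subseteq> cake"
      using al i by (auto simp: allocation_def)
    then have "0 \<le> a" "a \<le> b" "b \<le> 1"
      using ab ne by (auto simp: cake_def)
    moreover have "a \<noteq> b"
      using valuation_point[OF val[OF i], of a] gt[OF i] w[OF i] ab sub \<open>a \<le> b\<close> by auto
    ultimately show ?thesis using ab gt[OF i] by auto
  qed
  then obtain a b where ab:
    "\<And>i. i < n \<Longrightarrow> X i = {a i..b i} \<and> 0 \<le> a i \<and> a i < b i \<and> b i \<le> 1 \<and> w i < V i {a i..b i}"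
    by metis
  have "b i \<le> a j" if ij: "i < n" "j < n" "i \<noteq> j" "a i \<le> a j" for i j
  proof (rule ccontr)
    assume "\<not> b i \<le> a j"
    define x where "x = (a j + min (b i) (b j)) / 2"
    have x: "a j < x" "x < b i" "x < b j"
      using \<open>\<not> b i \<le> a j\<close> ab[OF ij(2)] by (auto simp: x_def min_def)
    then have "x \<in> X i \<inter> X j" using ab[OF ij(1)] ab[OF ij(2)] ij(4) by auto
    moreover have "X i \<inter> X j \<subseteq> frontier (X i) \<inter> frontier (X j)"
      using al ij(1-3) by (simp add: allocation_def)
    ultimately have "x \<in> frontier (X i)" by auto
    moreover have "frontier (X i) = {a i, b i}"
      using ab[OF ij(1)] by (auto simp: frontier_def closure_closed)
    ultimately show False using x ij(4) by auto
  qed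
  then show ?thesis using ab by blast
qed

text \<open>A certificate of nonexistence. A piece of agent \<open>i\<close> that starts at or after
  \<open>B T\<close> and ends by \<open>B (insert i T)\<close> is worth at most \<open>w i\<close>.
  Reading the pieces from left to right, each must therefore end beyond the barrier of the agents
  served so far, and the last one beyond 1.\<close>

lemma no_csp_barrier:
  assumes V: "V \<in> profiles n" and w: "\<And>i. i < n \<Longrightarrow> 0 < w i"
    and cake: "\<And>T. T \<subseteq> {..<n} \<Longrightarrow> B T \<in> {0..1}" and B0: "B {} = 0" and B1: "B {..<n} = 1"
    and step: "\<And>T i. T \<subseteq> {..<n} \<Longrightarrow> i < n \<Longrightarrow> i \<notin> T \<Longrightarrow>
      V i {0..B (insert i T)} \<le> V i {0..B T} + w i"
  shows "\<not> csp n w V X"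
proof
  assume X: "csp n w V X"
  obtain a b where
    "\<forall>i<n. X i = {a i..b i} \<and> 0 \<le> a i \<and> a i < b i \<and> b i \<le> 1 \<and> w i < V i {a i..b i}"
    "\<forall>i<n. \<forall>j<n. i \<noteq> j \<longrightarrow> a i \<le> a j \<longrightarrow> b i \<le> a j"
    using csp_intervals[OF V w X] by blast
  note ab = this(1)[rule_format] and sep = this(2)[rule_format]
  have val: "valuation (V i)" if "i < n" for i
    using V that by (auto simp: profiles_def)
  have next_gt: "B (insert i T) < b i" if T: "T \<subseteq> {..<n}" "i < n" "i \<notin> T" "B T \<le> a i" for T i
  proof (rule ccontr)
    note i = ab[OF T(2)] and v = val[OF T(2)]
    assume "\<not> B (insert i T) < b i"
    then have "V i {0..b i} \<le> V i {0..B (insert i T)}"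
      using i cake[of "insert i T"] T by (intro valuation_cdf_mono[OF v]) auto
    also have "\<dots> \<le> V i {0..B T} + w i" using step T by blast
    also have "V i {0..B T} \<le> V i {0..a i}"
      using i cake[of T] T by (intro valuation_cdf_mono[OF v]) auto
    finally show False
      using i valuation_Icc[OF v, of "a i" "b i"] by auto
  qed
  \<comment> \<open>The induction builds \<open>T\<close> by always adding a remaining agent with
    the smallest left end.\<close>
  have prefix: "\<exists>T\<subseteq>{..<n}. card T = k \<and> (\<forall>i\<in>{..<n} - T. B T \<le> a i)" if "k \<le> n" for k
    using that
  proof (induction k)
    case 0
    then show ?case using ab B0 by (intro exI[of _ "{}"]) auto
  next
    case (Suc k)
    then obtain T where T: "T \<subseteq> {..<n}" "card T = k" "\<And>i. i < n \<Longrightarrow> i \<notin> T \<Longrightarrow> B T \<le> a i"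
      by auto
    have fin: "finite T" using T(1) finite_subset by blast
    have "{..<n} - T \<noteq> {}"
      using T(1,2) Suc.prems by auto
    then obtain i where i: "i < n" "i \<notin> T" "\<And>j. j < n \<Longrightarrow> j \<notin> T \<Longrightarrow> a i \<le> a j"
      using arg_min_if_finite[of "{..<n} - T" a] by (auto simp: not_less)
    have "B (insert i T) < b i" using T i by (intro next_gt) auto
    then have "\<forall>j\<in>{..<n} - insert i T. B (insert i T) \<le> a j"
      using sep[OF i(1)] i by fastforce
    then show ?case using T i fin by (intro exI[of _ "insert i T"]) auto
  qed
  show False
  proof (cases n)
    case 0
    then show False using B0 B1 by simp
  next
    case (Suc m)
    then obtain T where T: "T \<subseteq> {..<n}" "card T = m" "\<And>i. i < n \<Longrightarrow> i \<notin> T \<Longrightarrow> B T \<le> a i"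
      using prefix[of m] by auto
    then have fin: "finite T" using finite_subset by blast
    have "card T \<noteq> card {..<n}" using T Suc by simp
    then have "T \<noteq> {..<n}" by auto
    then obtain i where i: "i < n" "i \<notin> T" using T by auto
    have "insert i T = {..<n}"
      using T i fin Suc by (intro card_subset_eq) auto
    then show False using next_gt[of T i] T i ab[OF i(1)] B1 by auto
  qed
qed

text \<open>\<open>X\<close> stays arbitrary outside \<open>S\<close>. The condition
  \<open>y < z\<close> keeps pieces nondegenerate, so that the frontier of a piece is its pair of
  end points.\<close>

inductive tiled ::
  "(nat \<Rightarrow> real set \<Rightarrow> real) \<Rightarrow> (nat \<Rightarrow> real) \<Rightarrow> nat set \<Rightarrow> real \<Rightarrow> (nat \<Rightarrow> real set) \<Rightarrow> bool"
  for V w where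
  tiled_empty: "tiled V w {} 0 X"
| tiled_insert: "tiled V w S y X \<Longrightarrow> i \<notin> S \<Longrightarrow> y < z \<Longrightarrow> w i < V i {y..z} \<Longrightarrow>
    tiled V w (insert i S) z (X(i := {y..z}))"

lemma tiled_pieces:
  assumes "tiled V w S y X"
  shows "0 \<le> y \<and> finite S \<and> (S = {} \<longrightarrow> y = 0) \<and> (S \<noteq> {} \<longrightarrow> (\<Union>i\<in>S. X i) = {0..y})
    \<and> (\<forall>i\<in>S. w i < V i (X i) \<and> (\<exists>a b. 0 \<le> a \<and> a < b \<and> b \<le> y \<and> X i = {a..b}))
    \<and> (\<forall>i\<in>S. \<forall>j\<in>S. i \<noteq> j \<longrightarrow> X i \<inter> X j \<subseteq> frontier (X i) \<inter> frontier (X j))"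
  using assms
proof (induction rule: tiled.induct)
  case (tiled_empty X)
  then show ?case by simp
next
  case (tiled_insert S y X i z)
  let ?X = "X(i := {y..z})"
  from tiled_insert.IH have pc: "\<exists>a b. 0 \<le> a \<and> a < b \<and> b \<le> y \<and> X j = {a..b}" "w j < V j (X j)"
    if "j \<in> S" for j using that by auto
  from tiled_insert.IH have dj: "X j \<inter> X k \<subseteq> frontier (X j) \<inter> frontier (X k)"
    if "j \<in> S" "k \<in> S" "j \<noteq> k" for j k using that by simp
  have same: "?X j = X j" if "j \<in> S" for j using that tiled_insert.hyps by auto
  have fr: "frontier {a..b} = {a, b}" if "a < b" for a b :: real
    using that by (auto simp: frontier_def closure_closed)
  \<comment> \<open>The earlier piece ends at or before \<open>y\<close>, so the two can meet only
    in \<open>y\<close>, an end point of both.\<close>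
  have meet: "X j \<inter> {y..z} \<subseteq> frontier (X j) \<inter> frontier {y..z}" if jS: "j \<in> S" for j
  proof -
    obtain a b where "a < b" "b \<le> y" "X j = {a..b}"
      using pc(1)[OF jS] by blast
    then show ?thesis using tiled_insert.hyps fr by auto
  qed
  have "(\<Union>j\<in>S. ?X j) = (\<Union>j\<in>S. X j)"
    using same by (intro SUP_cong) auto
  then have "(\<Union>j\<in>insert i S. ?X j) = {y..z} \<union> (\<Union>j\<in>S. X j)"
    by (simp only: UN_insert fun_upd_same)
  also have "\<dots> = {0..z}"
    using tiled_insert.IH tiled_insert.hyps by (cases "S = {}") auto
  finally have un: "(\<Union>j\<in>insert i S. ?X j) = {0..z}" .
  have pcs: "\<forall>j\<in>insert i S. w j < V j (?X j) \<and> (\<exists>a b. 0 \<le> a \<and> a < b \<and> b \<le> z \<and> ?X j = {a..b})"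
  proof
    fix j assume "j \<in> insert i S"
    then consider "j = i" | "j \<in> S" "j \<noteq> i" using tiled_insert.hyps by blast
    then show "w j < V j (?X j) \<and> (\<exists>a b. 0 \<le> a \<and> a < b \<and> b \<le> z \<and> ?X j = {a..b})"
    proof cases
      case 1
      then show ?thesis using tiled_insert by auto
    next
      case 2
      then obtain a b where "0 \<le> a" "a < b" "b \<le> y" "X j = {a..b}" "w j < V j (X j)"
        using pc by metis
      then show ?thesis using 2 tiled_insert.hyps
        by (auto intro!: exI[of _ a] exI[of _ b])
    qed
  qed
  have "\<forall>j\<in>insert i S. \<forall>k\<in>insert i S. j \<noteq> k \<longrightarrow> ?X j \<inter> ?X k \<subseteq> frontier (?X j) \<inter> frontier (?X k)"
  proof (intro ballI impI)
    fix j k assume "j \<in> insert i S" "k \<in> insert i S" "j \<noteq> k"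
    then consider "j \<in> S" "k \<in> S" "j \<noteq> k" | "j = i" "k \<in> S" | "k = i" "j \<in> S" by blast
    then show "?X j \<inter> ?X k \<subseteq> frontier (?X j) \<inter> frontier (?X k)"
    proof cases
      case 1
      then show ?thesis using same dj by metis
    next
      case 2
      then show ?thesis using same[of k] meet[of k] by auto
    next
      case 3
      then show ?thesis using same[of j] meet[of j] by auto
    qed
  qed
  moreover have "0 \<le> z" "finite (insert i S)"
    using tiled_insert.IH tiled_insert.hyps by auto
  ultimately show ?case using un pcs by simp
qed

lemma csp_if_tiled:
  assumes "tiled V w {..<n} 1 X" "0 < n"
  shows "csp n w V X"
proof -
  note t = tiled_pieces[OF assms(1)]
  have "\<exists>a b. 0 \<le> a \<and> a < b \<and> b \<le> 1 \<and> X i = {a..b}" if "i < n" for i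
    using t that by blast
  then have "is_interval (X i)" "\<exists>F. finite F \<and> (\<forall>I\<in>F. \<exists>a b. a \<le> b \<and> I = {a..b}) \<and> X i = \<Union>F"
    if "i < n" for i
    using that by (metis is_interval_cc, intro exI[of _ "{X i}"], fastforce)
  moreover have "{..<n} \<noteq> {}" using assms(2) by auto
  ultimately show ?thesis
    using t unfolding csp_def connected_allocation_def allocation_def strongly_proportional_def cake_def
    by auto
qed

section \<open>The upper bound\<close>

text \<open>A mark at the right end of the cake is as useless as an infinite one, so both become \<open>1\<close>.
  The remaining ereals are never answers; they are mapped into the cake to keep protocols legal.\<close>

definition clip :: "ereal \<Rightarrow> real" where
  "clip v = (if v \<in> ereal ` cake then real_of_ereal v else 1)"

lemma clip_cake: "clip v \<in> cake"
  by (auto simp: clip_def cake_def)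

lemma clip_ereal: "x \<in> cake \<Longrightarrow> clip (ereal x) = x"
  by (auto simp: clip_def)

lemma clip_infinity: "clip \<infinity> = 1"
  by (auto simp: clip_def)

text \<open>The intermediate value theorem makes the set of solutions nonempty and continuity makes
  it compact, so a largest one exists; beyond it the value is strictly above the target. An infinite
  mark becomes 1, for which the unconditional claims hold as well.\<close>

lemma mark_props:
  assumes V: "valuation (V i)" and x: "x \<in> cake" and r: "0 < r"
  defines "a \<equiv> clip (answer V (Mark i x r))"
  shows mark_ge: "x \<le> a"
    and mark_cdf_le: "V i {0..a} \<le> V i {0..x} + r"
    and mark_cdf_eq: "r \<le> V i {x..1} \<Longrightarrow> V i {0..a} = V i {0..x} + r"
    and mark_less: "\<And>y. y \<in> cake \<Longrightarrow> a < y \<Longrightarrow> r < V i {x..y}"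
proof -
  have x01: "0 \<le> x" "x \<le> 1" using x by (auto simp: cake_def)
  note Icc = valuation_Icc[OF V]
  have "x \<le> a \<and> V i {0..a} \<le> V i {0..x} + r \<and> (r \<le> V i {x..1} \<longrightarrow> V i {0..a} = V i {0..x} + r)
    \<and> (\<forall>y\<in>cake. a < y \<longrightarrow> r < V i {x..y})"
  proof (cases "V i {x..1} < r")
    case True
    then have "a = 1" by (simp add: a_def clip_infinity)
    then show ?thesis using x01 Icc[of x 1] True by (auto simp: cake_def)
  next
    case False
    define Z where "Z = {z \<in> {x..1}. V i {0..z} = V i {0..x} + r}"
    have cont: "continuous_on {x..1} (\<lambda>z. V i {0..z})"
      using V x01 unfolding valuation_def by (auto simp: cake_def elim: continuous_on_subset)
    have "closed Z"
      unfolding Z_def using cont by (intro continuous_closed_preimage_constant) auto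
    moreover have "bounded Z"
      by (rule bounded_subset[of "{x..1}"]) (auto simp: Z_def)
    moreover have "\<exists>z\<ge>x. z \<le> 1 \<and> V i {0..z} = V i {0..x} + r"
      using r False Icc[of x 1] x01 by (intro IVT' cont) auto
    then have "Z \<noteq> {}" by (auto simp: Z_def)
    ultimately obtain z where z: "z \<in> Z" "\<And>t. t \<in> Z \<Longrightarrow> t \<le> z"
      using compact_attains_sup[of Z] by (auto simp: compact_eq_bounded_closed)
    have "t \<in> Z" if t: "t \<in> cake" "V i {x..t} = r" for t
    proof -
      \<comment> \<open>A solution left of \<open>x\<close> would measure the empty interval, worth
        0, but \<open>r\<close> is positive.\<close>
      have "x \<le> t"
      proof (rule ccontr)
        assume "\<not> x \<le> t"
        then have "{x..t} = {}" by simp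
        then show False using t(2) r valuation_empty[OF V] by simp
      qed
      then show ?thesis using t Icc[of x t] x01 by (auto simp: Z_def cake_def)
    qed
    moreover have "V i {x..z} = r" "z \<in> cake"
      using z(1) Icc[of x z] x01 by (auto simp: Z_def cake_def)
    ultimately have "(GREATEST t. t \<in> cake \<and> V i {x..t} = r) = z"
      using z(2) by (intro Greatest_equality) blast+
    then have az: "a = z"
      using False z(1) x01 by (simp add: a_def clip_ereal cake_def Z_def)
    have "r < V i {x..y}" if y: "y \<in> cake" "a < y" for y
    proof -
      have y1: "z \<le> y" "y \<le> 1" using y az by (auto simp: cake_def)
      have "y \<notin> Z" using z(2) y(2) az by force
      then have "V i {0..y} \<noteq> V i {0..x} + r"
        using y1 z(1) by (auto simp: Z_def)
      moreover have "V i {0..z} \<le> V i {0..y}"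
        using y1 z(1) x01 by (intro valuation_cdf_mono[OF V]) (auto simp: Z_def)
      ultimately show ?thesis
        using z(1) Icc[of x y] x01 y1 by (auto simp: Z_def)
    qed
    then show ?thesis using az z(1) by (auto simp: Z_def)
  qed
  then show "x \<le> a" "V i {0..a} \<le> V i {0..x} + r" "r \<le> V i {x..1} \<Longrightarrow> V i {0..a} = V i {0..x} + r"
    "\<And>y. y \<in> cake \<Longrightarrow> a < y \<Longrightarrow> r < V i {x..y}"
    by blast+
qed

section \<open>Mapping, sequencing and adaptive batches of queries\<close>

lemma run_map: "run V (map_protocol f P) = f (run V P)"
  by (induction P) auto

lemma num_queries_map: "num_queries V (map_protocol f P) = num_queries V P"
  by (induction P) auto

lemma legal_map: "legal n (map_protocol f P) = legal n P"
  by (induction P) auto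

primrec bind_protocol :: "'a protocol \<Rightarrow> ('a \<Rightarrow> 'b protocol) \<Rightarrow> 'b protocol" where
  "bind_protocol (Output a) f = f a"
| "bind_protocol (Ask q k) f = Ask q (\<lambda>v. bind_protocol (k v) f)"

lemma run_bind: "run V (bind_protocol P f) = run V (f (run V P))"
  by (induction P) auto

lemma num_queries_bind:
  "num_queries V (bind_protocol P f) = num_queries V P + num_queries V (f (run V P))"
  by (induction P) auto

lemma legal_bind: "legal n P \<Longrightarrow> (\<And>a. legal n (f a)) \<Longrightarrow> legal n (bind_protocol P f)"
  by (induction P) auto

text \<open>The history \<open>h\<close> stores answers by index, so query number \<open>t\<close>
  may depend on all earlier answers while the number of queries is fixed in advance.\<close>

primrec ask_all ::
  "(nat \<Rightarrow> (nat \<Rightarrow> ereal) \<Rightarrow> query) \<Rightarrow> nat \<Rightarrow> nat \<Rightarrow> (nat \<Rightarrow> ereal) \<Rightarrow> (nat \<Rightarrow> ereal) protocol" where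
  "ask_all q 0 t h = Output h"
| "ask_all q (Suc N) t h = Ask (q t h) (\<lambda>v. ask_all q N (Suc t) (h(t := v)))"

lemma num_queries_ask_all: "num_queries V (ask_all q N t h) = N"
  by (induction N arbitrary: t h) auto

lemma legal_ask_all: "(\<And>s g. legal_query n (q s g)) \<Longrightarrow> legal n (ask_all q N t h)"
  by (induction N arbitrary: t h) auto

text \<open>Causality lets each query be evaluated on the final history instead of the partial one.
  The run thus yields a table that satisfies its own recursion.\<close>

lemma run_ask_all:
  assumes causal: "\<And>s g g'. (\<And>r. r < s \<Longrightarrow> g r = g' r) \<Longrightarrow> q s g = q s g'"
  shows "(\<forall>s<t. run V (ask_all q N t h) s = h s) \<and>
    (\<forall>s. t \<le> s \<longrightarrow> s < t + N \<longrightarrow>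
      run V (ask_all q N t h) s = answer V (q s (run V (ask_all q N t h))))"
proof (induction N arbitrary: t h)
  case 0
  then show ?case by simp
next
  case (Suc N)
  define H where "H = run V (ask_all q (Suc N) t h)"
  have H: "H = run V (ask_all q N (Suc t) (h(t := answer V (q t h))))"
    by (simp add: H_def)
  have a: "H s = (h(t := answer V (q t h))) s" if "s < Suc t" for s
    using Suc[of "Suc t" "h(t := answer V (q t h))"] that unfolding H by blast
  have b: "H s = answer V (q s H)" if "Suc t \<le> s" "s < Suc t + N" for s
    using Suc[of "Suc t" "h(t := answer V (q t h))"] that unfolding H by blast
  have "q t H = q t h" by (rule causal) (use a in auto)
  then have "H t = answer V (q t H)" using a[of t] by simp
  then have "H s = answer V (q s H)" if "t \<le> s" "s < t + Suc N" for s
    using b[of s] that by (cases "s = t") auto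
  moreover have "H s = h s" if "s < t" for s
    using a[of s] that by simp
  ultimately show ?case unfolding H_def by blast
qed

text \<open>Answer number \<open>n * set_encode S + i\<close> is the mark of agent \<open>i \<in> S\<close> with target \<open>w i\<close>, started at
  the value of \<open>S - {i}\<close>. Since \<open>set_encode (S - {i}) < set_encode S\<close>, that value is determined by
  earlier answers.\<close>

definition dp :: "nat \<Rightarrow> (nat \<Rightarrow> ereal) \<Rightarrow> nat set \<Rightarrow> real" where
  "dp n h S = (if S = {} then 0 else Min ((\<lambda>i. clip (h (n * set_encode S + i))) ` S))"

text \<open>Indices with \<open>i \<notin> S\<close> carry a dummy query, which keeps positions in
  the table computable from \<open>S\<close> and \<open>i\<close>.\<close>

definition dp_query :: "nat \<Rightarrow> (nat \<Rightarrow> real) \<Rightarrow> nat \<Rightarrow> (nat \<Rightarrow> ereal) \<Rightarrow> query" where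
  "dp_query n w t h = (let S = set_decode (t div n); i = t mod n in
     if S \<subseteq> {..<n} \<and> i \<in> S then Mark i (dp n h (S - {i})) (w i) else Eval i 0 0)"

definition dp_choice :: "nat \<Rightarrow> (nat \<Rightarrow> ereal) \<Rightarrow> nat set \<Rightarrow> nat" where
  "dp_choice n h S = (SOME i. i \<in> S \<and> dp n h S = clip (h (n * set_encode S + i)))"

lemma dp_cake:
  assumes "finite S"
  shows "dp n h S \<in> cake"
proof (cases "S = {}")
  case False
  then have "dp n h S \<in> (\<lambda>i. clip (h (n * set_encode S + i))) ` S"
    using assms unfolding dp_def by (simp del: Min_in) (intro Min_in, auto)
  then show ?thesis using clip_cake by auto
qed (auto simp: dp_def cake_def)

lemma dp_choice:
  assumes "finite S" "S \<noteq> {}"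
  shows "dp_choice n h S \<in> S" "dp n h S = clip (h (n * set_encode S + dp_choice n h S))"
proof -
  have "Min ((\<lambda>i. clip (h (n * set_encode S + i))) ` S) \<in> (\<lambda>i. clip (h (n * set_encode S + i))) ` S"
    using assms by (intro Min_in) auto
  then have "\<exists>i. i \<in> S \<and> dp n h S = clip (h (n * set_encode S + i))"
    using assms unfolding dp_def by (metis (no_types, lifting) imageE)
  from someI_ex[OF this] show "dp_choice n h S \<in> S" "dp n h S = clip (h (n * set_encode S + dp_choice n h S))"
    by (auto simp: dp_choice_def)
qed

lemma set_encode_Diff:
  assumes "finite S" "i \<in> S"
  shows "set_encode S = 2 ^ i + set_encode (S - {i})"
  using set_encode_insert[of "S - {i}" i] assms by (simp add: insert_absorb)

lemma set_encode_less:
  assumes "S \<subseteq> {..<n}"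
  shows "set_encode S < 2 ^ n"
proof -
  have "set_encode S \<le> set_encode {..<n}"
    unfolding set_encode_def using assms by (intro sum_mono2) auto
  also have "\<dots> = 2 ^ n - 1"
    by (simp add: set_encode_def lessThan_atLeast0 sum_power2)
  also have "\<dots> < 2 ^ n" by simp
  finally show ?thesis .
qed

lemma dp_query_causal:
  assumes n: "0 < n" and eq: "\<And>r. r < t \<Longrightarrow> g r = g' r"
  shows "dp_query n w t g = dp_query n w t g'"
proof -
  define S i where "S = set_decode (t div n)" and "i = t mod n"
  have "dp n g (S - {i}) = dp n g' (S - {i})" if S: "S \<subseteq> {..<n}" "i \<in> S"
  proof -
    have "n * set_encode (S - {i}) + j < t" if "j \<in> S - {i}" for j
    proof -
      have fin: "finite S" using S(1) finite_subset by blast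
      have "j < n" using that S by auto
      then have "n * set_encode (S - {i}) + j < n * (set_encode (S - {i}) + 1)" by simp
      also have "\<dots> \<le> n * set_encode S"
        using set_encode_Diff[OF fin S(2)] by (intro mult_le_mono2) simp
      also have "\<dots> \<le> t" by (simp add: S_def)
      finally show ?thesis .
    qed
    then have "(\<lambda>j. clip (g (n * set_encode (S - {i}) + j))) ` (S - {i})
      = (\<lambda>j. clip (g' (n * set_encode (S - {i}) + j))) ` (S - {i})"
      using eq by (intro image_cong) auto
    then show ?thesis by (simp add: dp_def)
  qed
  then show ?thesis by (auto simp: dp_query_def Let_def S_def i_def)
qed

lemma legal_dp_query:
  assumes "0 < n" "\<And>i. i < n \<Longrightarrow> 0 < w i"
  shows "legal_query n (dp_query n w t h)"
  using assms dp_cake[of "set_decode (t div n) - {t mod n}" n h]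
  by (auto simp: dp_query_def Let_def cake_def less_imp_le)

definition dp_protocol :: "nat \<Rightarrow> (nat \<Rightarrow> real) \<Rightarrow> (nat \<Rightarrow> ereal) protocol" where
  "dp_protocol n w = ask_all (dp_query n w) (n * 2 ^ n) 0 (\<lambda>_. 0)"

lemma run_dp_protocol:
  fixes V :: "nat \<Rightarrow> real set \<Rightarrow> real" and w :: "nat \<Rightarrow> real"
  assumes n: "0 < n" and S: "S \<subseteq> {..<n}" "i \<in> S"
  defines "H \<equiv> run V (dp_protocol n w)"
  shows "H (n * set_encode S + i) = answer V (Mark i (dp n H (S - {i})) (w i))"
proof -
  let ?t = "n * set_encode S + i"
  have i: "i < n" and fin: "finite S" using S finite_subset by auto
  have "?t < n * (set_encode S + 1)" using i by simp
  also have "\<dots> \<le> n * 2 ^ n" using set_encode_less[OF S(1)] by (intro mult_le_mono2) simp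
  finally have "?t < 0 + n * 2 ^ n" by simp
  moreover have "\<forall>s\<ge>0. s < 0 + n * 2 ^ n \<longrightarrow> H s = answer V (dp_query n w s H)"
    unfolding H_def dp_protocol_def using run_ask_all[of "dp_query n w", OF dp_query_causal[OF n]] by blast
  ultimately have "H ?t = answer V (dp_query n w ?t H)" by blast
  moreover have "set_decode (?t div n) = S" "?t mod n = i"
    using i fin by (auto simp: set_encode_inverse)
  ultimately show ?thesis using S by (simp add: dp_query_def)
qed

text \<open>The points found by the recursion are only infima of feasible cuts. Going from right to left,
  the surplus of an agent over \<open>w i\<close> on \<open>[z, y]\<close> is measured, and the left cut is moved from the
  infimum \<open>z\<close> to the right by half of it, which leaves slack for the next agent.\<close>

primrec refine ::
  "(nat \<Rightarrow> real) \<Rightarrow> (nat set \<Rightarrow> real) \<Rightarrow> (nat set \<Rightarrow> nat) \<Rightarrow> nat \<Rightarrow> nat set \<Rightarrow> real \<Rightarrow>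
    (nat \<Rightarrow> real set) protocol" where
  "refine w B c 0 S y = Output (\<lambda>_. {})"
| "refine w B c (Suc k) S y =
    Ask (Eval (c S) (min (B (S - {c S})) y) y) (\<lambda>v.
      Ask (Mark (c S) (B (S - {c S})) (max 0 ((real_of_ereal v - w (c S)) / 2))) (\<lambda>u.
        map_protocol (\<lambda>X. X(c S := {if S = {c S} then 0 else clip u..y}))
          (refine w B c k (S - {c S}) (if S = {c S} then 0 else clip u))))"

lemma num_queries_refine: "num_queries V (refine w B c k S y) = 2 * k"
  by (induction k arbitrary: S y) (auto simp: num_queries_map)

text \<open>Legality quantifies over all answers, also those that no valuation gives. For these,
  \<open>min\<close>, \<open>max 0\<close> and \<open>clip\<close> in \<open>refine\<close> keep end
  points ordered, targets nonnegative and cuts in the cake.\<close>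

lemma legal_refine:
  assumes B: "\<And>T. T \<subseteq> {..<n} \<Longrightarrow> B T \<in> cake"
    and c: "\<And>T. T \<subseteq> {..<n} \<Longrightarrow> T \<noteq> {} \<Longrightarrow> c T \<in> T"
  shows "S \<subseteq> {..<n} \<Longrightarrow> card S = k \<Longrightarrow> y \<in> cake \<Longrightarrow> legal n (refine w B c k S y)"
proof (induction k arbitrary: S y)
  case 0
  then show ?case by simp
next
  case (Suc k)
  have cS: "c S \<in> S" using Suc.prems by (intro c) auto
  have "finite S" using Suc.prems finite_subset by blast
  then have k: "card (S - {c S}) = k" using cS Suc.prems by simp
  have BS: "B (S - {c S}) \<in> cake" using Suc.prems by (intro B) auto
  have "legal n (refine w B c k (S - {c S}) (if S = {c S} then 0 else clip u))" for u
    using Suc.prems k clip_cake[of u] by (intro Suc.IH) (auto simp: cake_def)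
  then show ?case
    using cS Suc.prems BS by (auto simp: legal_map cake_def)
qed

text \<open>The invariant is \<open>B S < y\<close>. By maximality of marks, agent
  \<open>c S\<close> then has a strict surplus between \<open>B (S - {c S})\<close> and
  \<open>y\<close>; giving up half of it restores the invariant for the smaller set.\<close>

lemma tiled_refine:
  assumes V: "V \<in> profiles n" and w: "\<And>i. i < n \<Longrightarrow> 0 < w i"
    and B: "\<And>T. T \<subseteq> {..<n} \<Longrightarrow> B T \<in> cake" and B0: "B {} = 0"
    and c: "\<And>T. T \<subseteq> {..<n} \<Longrightarrow> T \<noteq> {} \<Longrightarrow> c T \<in> T"
    and BS: "\<And>T. T \<subseteq> {..<n} \<Longrightarrow> T \<noteq> {} \<Longrightarrow>
      B T = clip (answer V (Mark (c T) (B (T - {c T})) (w (c T))))"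
  shows "S \<subseteq> {..<n} \<Longrightarrow> card S = k \<Longrightarrow> y \<in> cake \<Longrightarrow> (if S = {} then y = 0 else B S < y) \<Longrightarrow>
    tiled V w S y (run V (refine w B c k S y))"
proof (induction k arbitrary: S y)
  case 0
  moreover have "finite S" using 0 finite_subset by blast
  ultimately have "S = {}" by simp
  then show ?case using 0 by (auto intro: tiled_empty)
next
  case (Suc k)
  define i z where "i = c S" and "z = B (S - {i})"
  have ne: "S \<noteq> {}" and fin: "finite S" using Suc.prems finite_subset by auto
  have iS: "i \<in> S" unfolding i_def using Suc.prems ne by (intro c) auto
  then have i: "i < n" using Suc.prems by auto
  have val: "valuation (V i)" using V i by (auto simp: profiles_def)
  have k: "card (S - {i}) = k" using iS fin Suc.prems by simp
  have zc: "z \<in> cake" unfolding z_def using Suc.prems by (intro B) auto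
  have BSi: "B S = clip (answer V (Mark i z (w i)))"
    using BS[of S] Suc.prems ne by (simp add: i_def z_def)
  have By: "B S < y" using Suc.prems ne by simp
  have zB: "z \<le> B S" unfolding BSi by (rule mark_ge[of V i, OF val zc w[OF i]])
  have wi: "w i < V i {z..y}"
    using mark_less[of V i, OF val zc w[OF i], of y] Suc.prems By BSi by simp
  define r where "r = (V i {z..y} - w i) / 2"
  define u where "u = clip (answer V (Mark i z r))"
  \<comment> \<open>The leftmost piece must start exactly at 0. There \<open>z = B {} = 0\<close>,
    so this agent keeps its whole surplus.\<close>
  define y' where "y' = (if S = {i} then 0 else u)"
  have r: "0 < r" using wi by (simp add: r_def)
  have yz: "0 \<le> z" "z < y" "y \<le> 1" using zc Suc.prems zB By by (auto simp: cake_def)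
  have run: "run V (refine w B c (Suc k) S y) = (run V (refine w B c k (S - {i}) y'))(i := {y'..y})"
  proof -
    have "min (B (S - {c S})) y = B (S - {c S})" "max 0 r = r"
      using yz r by (auto simp: z_def i_def)
    then show ?thesis
      by (simp add: run_map y'_def u_def r_def z_def i_def del: answer.simps(2))
  qed
  have uc: "u \<in> cake" unfolding u_def by (rule clip_cake)
  \<comment> \<open>This makes the mark finite, so the cut \<open>u\<close> takes exactly
    \<open>r\<close> from the surplus \<open>2 * r\<close>.\<close>
  have "r \<le> V i {z..1}"
    using valuation_Icc[OF val, of z 1] valuation_Icc[OF val, of z y]
      valuation_cdf_mono[OF val, of y 1] yz w[OF i] wi by (simp add: r_def)
  then have ueq: "V i {0..u} = V i {0..z} + r"
    unfolding u_def by (rule mark_cdf_eq[of V i, OF val zc r])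
  have zu: "z \<le> u" unfolding u_def by (rule mark_ge[of V i, OF val zc r])
  have "z \<noteq> u" using ueq r by auto
  have "u < y"
  proof (rule ccontr)
    assume "\<not> u < y"
    then have "V i {0..y} \<le> V i {0..u}"
      using yz uc by (intro valuation_cdf_mono[OF val]) (auto simp: cake_def)
    then show False using ueq valuation_Icc[OF val, of z y] yz wi w[OF i] by (simp add: r_def field_simps)
  qed
  have gain: "w i < V i {y'..y} \<and> y' < y"
  proof (cases "S = {i}")
    case True
    then have "z = 0" using B0 by (simp add: z_def)
    then show ?thesis using wi yz True by (simp add: y'_def)
  next
    case False
    have "V i {u..y} = V i {0..y} - V i {0..u}"
      using yz uc \<open>u < y\<close> by (intro valuation_Icc[OF val]) (auto simp: cake_def)
    also have "\<dots> = V i {z..y} - r" using ueq valuation_Icc[OF val, of z y] yz by simp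
    finally show ?thesis using False wi \<open>u < y\<close> by (simp add: y'_def r_def field_simps)
  qed
  have "tiled V w (S - {i}) y' (run V (refine w B c k (S - {i}) y'))"
  proof (rule Suc.IH)
    show "S - {i} \<subseteq> {..<n}" using Suc.prems by auto
    show "y' \<in> cake" using uc by (simp add: y'_def cake_def)
    show "if S - {i} = {} then y' = 0 else B (S - {i}) < y'"
      using zu \<open>z \<noteq> u\<close> iS by (auto simp: y'_def z_def)
  qed (rule k)
  from tiled_insert[OF this _ _ _, of i y] gain
  have "tiled V w (insert i (S - {i})) y ((run V (refine w B c k (S - {i}) y'))(i := {y'..y}))"
    by simp
  then show ?case using iS by (simp only: run insert_Diff)
qed

definition csp_protocol :: "nat \<Rightarrow> (nat \<Rightarrow> real) \<Rightarrow> (nat \<Rightarrow> real set) option protocol" where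
  "csp_protocol n w = bind_protocol (dp_protocol n w) (\<lambda>h.
     if dp n h {..<n} < 1
     then map_protocol Some (refine w (dp n h) (dp_choice n h) n {..<n} 1)
     else Output None)"

lemma num_queries_csp_protocol: "num_queries V (csp_protocol n w) \<le> n * 2 ^ n + 2 * n"
  by (simp add: csp_protocol_def num_queries_bind dp_protocol_def num_queries_ask_all
      num_queries_map num_queries_refine)

lemma legal_csp_protocol:
  assumes "0 < n" "\<And>i. i < n \<Longrightarrow> 0 < w i"
  shows "legal n (csp_protocol n w)"
proof -
  have "legal n (refine w (dp n h) (dp_choice n h) n {..<n} 1)" for h
  proof (rule legal_refine)
    fix T :: "nat set" assume "T \<subseteq> {..<n}"
    then have "finite T" using finite_subset by blast
    then show "dp n h T \<in> cake" "T \<noteq> {} \<Longrightarrow> dp_choice n h T \<in> T"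
      by (auto intro: dp_cake dp_choice)
  qed (auto simp: cake_def)
  then show ?thesis
    using legal_dp_query[of n w] assms
    by (auto simp: csp_protocol_def dp_protocol_def legal_map intro!: legal_bind legal_ask_all)
qed

text \<open>If the recursion ends below 1, its values drive \<open>refine\<close>. Otherwise they
  form a barrier themselves: each is a minimum of marks, and a mark never overshoots its
  target.\<close>

lemma csp_protocol_correct:
  assumes n: "0 < n" and w: "\<And>i. i < n \<Longrightarrow> 0 < w i" and V: "V \<in> profiles n"
  shows "case run V (csp_protocol n w) of Some X \<Rightarrow> csp n w V X | None \<Rightarrow> \<not> (\<exists>X. csp n w V X)"
proof -
  define H where "H = run V (dp_protocol n w)"
  have fin: "finite T" if "T \<subseteq> {..<n}" for T using that finite_subset by blast
  note H = run_dp_protocol[OF n, of _ _ V w, folded H_def]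
  show ?thesis
  proof (cases "dp n H {..<n} < 1")
    case True
    have "tiled V w {..<n} 1 (run V (refine w (dp n H) (dp_choice n H) n {..<n} 1))"
    proof (rule tiled_refine[OF V w])
      fix T :: "nat set" assume T: "T \<subseteq> {..<n}" "T \<noteq> {}"
      show "dp_choice n H T \<in> T" by (rule dp_choice[OF fin[OF T(1)] T(2)])
      then show "dp n H T =
          clip (answer V (Mark (dp_choice n H T) (dp n H (T - {dp_choice n H T})) (w (dp_choice n H T))))"
        using H[OF T(1)] dp_choice(2)[OF fin[OF T(1)] T(2), of n H] by metis
    next
      show "dp n H T \<in> cake" if "T \<subseteq> {..<n}" for T by (rule dp_cake[OF fin[OF that]])
      show "if {..<n} = {} then (1::real) = 0 else dp n H {..<n} < 1" using True n by auto
    qed (auto simp: cake_def dp_def)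
    then have "csp n w V (run V (refine w (dp n H) (dp_choice n H) n {..<n} 1))"
      by (rule csp_if_tiled[OF _ n])
    then show ?thesis
      using True by (simp add: csp_protocol_def run_bind H_def[symmetric] run_map)
  next
    case False
    have "\<not> csp n w V X" for X
    proof (rule no_csp_barrier[OF V w])
      show "dp n H T \<in> {0..1}" if "T \<subseteq> {..<n}" for T
        using dp_cake[OF fin[OF that]] by (simp add: cake_def)
      then show "dp n H {..<n} = 1" using False by force
      show "dp n H {} = 0" by (simp add: dp_def)
      fix T i assume T: "T \<subseteq> {..<n}" "i < n" "i \<notin> T"
      have val: "valuation (V i)" using V T by (auto simp: profiles_def)
      let ?a = "clip (answer V (Mark i (dp n H T) (w i)))"
      have "dp n H (insert i T) \<le> ?a"
        using H[of "insert i T" i] T fin[OF T(1)] by (auto simp: dp_def intro!: Min_le)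
      then have "V i {0..dp n H (insert i T)} \<le> V i {0..?a}"
        using dp_cake[of "insert i T" n H] fin[OF T(1)] clip_cake[of "answer V (Mark i (dp n H T) (w i))"]
        by (intro valuation_cdf_mono[OF val]) (auto simp: cake_def)
      also have "\<dots> \<le> V i {0..dp n H T} + w i"
        using w T by (intro mark_cdf_le[of V i, OF val]) (auto intro: dp_cake fin)
      finally show "V i {0..dp n H (insert i T)} \<le> V i {0..dp n H T} + w i" .
    qed
    then show ?thesis
      using False by (simp add: csp_protocol_def run_bind H_def[symmetric])
  qed
qed

section \<open>Valuations with a given distribution function\<close>

definition distribution :: "(real \<Rightarrow> real) \<Rightarrow> bool" where
  "distribution F \<longleftrightarrow> continuous_on {0..1} F \<and> mono_on {0..1} F \<and> F 0 = 0 \<and> F 1 = 1"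

text \<open>The Lebesgue-Stieltjes measure of \<open>F\<close>, extended constantly outside the
  cake.\<close>

definition interval_valuation :: "(real \<Rightarrow> real) \<Rightarrow> real set \<Rightarrow> real" where
  "interval_valuation F = measure (interval_measure (\<lambda>x. F (max 0 (min 1 x))))"

lemma interval_algebra_borel:
  assumes "A \<in> interval_algebra"
  shows "A \<in> sets borel" "A \<subseteq> cake"
proof -
  let ?M = "{A \<in> sets borel. A \<subseteq> cake}"
  have "algebra cake ?M"
    unfolding algebra_iff_Un by (auto simp: cake_def)
  moreover have "{I. is_interval I \<and> I \<subseteq> cake} \<subseteq> ?M"
    using real_interval_borel_measurable by auto
  ultimately have "interval_algebra \<subseteq> ?M"
    unfolding interval_algebra_def by (intro Inter_lower) simp
  then show "A \<in> sets borel" "A \<subseteq> cake" using assms by auto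
qed

lemma
  assumes F: "distribution F"
  shows interval_valuation_Icc:
      "\<And>x y. 0 \<le> x \<Longrightarrow> x \<le> y \<Longrightarrow> y \<le> 1 \<Longrightarrow> interval_valuation F {x..y} = F y - F x"
    and valuation_interval_valuation: "valuation (interval_valuation F)"
proof -
  define G where "G = (\<lambda>x. F (max 0 (min 1 x)))"
  have mono: "F x \<le> F y" if "0 \<le> x" "x \<le> y" "y \<le> 1" for x y
    using F that by (auto simp: distribution_def mono_on_def)
  have contF: "continuous_on {0..1} F" using F by (simp add: distribution_def)
  have Gmono: "G x \<le> G y" if "x \<le> y" for x y
    unfolding G_def using that by (intro mono) auto
  have "continuous_on UNIV G"
    unfolding G_def by (rule continuous_on_compose2[OF contF]) (auto intro!: continuous_intros)
  then have em: "emeasure (interval_measure G) {x..y} = ennreal (G y - G x)" if "x \<le> y" for x y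
    using emeasure_interval_measure_Icc[OF that Gmono] by simp
  have Icc: "interval_valuation F {x..y} = F y - F x" if "0 \<le> x" "x \<le> y" "y \<le> 1" for x y
  proof -
    have "interval_valuation F {x..y} = enn2real (ennreal (G y - G x))"
      using em[OF that(2)] by (simp add: interval_valuation_def measure_def G_def)
    also have "\<dots> = G y - G x" using Gmono that by simp
    finally show ?thesis using that by (simp add: G_def)
  qed
  then show "\<And>x y. 0 \<le> x \<Longrightarrow> x \<le> y \<Longrightarrow> y \<le> 1 \<Longrightarrow> interval_valuation F {x..y} = F y - F x" .
  have fin: "emeasure (interval_measure G) A \<noteq> \<infinity>" if "A \<subseteq> {0..1}" for A
  proof -
    have "emeasure (interval_measure G) A \<le> emeasure (interval_measure G) {0..1}"
      using that by (intro emeasure_mono) auto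
    also have "\<dots> < \<infinity>" using em[of 0 1] by simp
    finally show ?thesis by simp
  qed
  have add: "Measure_Space.additive interval_algebra (interval_valuation F)"
    unfolding Measure_Space.additive_def
  proof (intro ballI impI)
    fix A B assume AB: "A \<in> interval_algebra" "B \<in> interval_algebra" "A \<inter> B = {}"
    note a = interval_algebra_borel[OF AB(1)] and b = interval_algebra_borel[OF AB(2)]
    have "measure (interval_measure G) (A \<union> B)
        = measure (interval_measure G) A + measure (interval_measure G) B"
      using a b AB(3) fin by (intro measure_Union) (auto simp: cake_def)
    then show "interval_valuation F (A \<union> B) = interval_valuation F A + interval_valuation F B"
      by (simp add: interval_valuation_def G_def)
  qed
  have "continuous_on cake (\<lambda>x. interval_valuation F {0..x})"
    using contF Icc[of 0] F
    by (subst continuous_on_cong[OF refl, of _ _ F]) (auto simp: cake_def distribution_def)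
  then show "valuation (interval_valuation F)"
    using add Icc[of 0 1] Icc[of 0 0] F
    by (auto simp: valuation_def cake_def distribution_def interval_valuation_def)
qed

text \<open>Beyond \<open>z\<close> a strictly increasing \<open>F\<close> exceeds the target, so a
  solution \<open>z\<close> is already the largest. Two such functions that agree at
  \<open>x\<close> and \<open>z\<close> therefore give the same mark.\<close>

lemma answer_Mark_strict:
  assumes F: "distribution F" and strict: "strict_mono_on {0..1} F" and V: "V i = interval_valuation F"
    and z: "0 \<le> x" "x \<le> z" "z \<le> 1" "F z = F x + r"
  shows "answer V (Mark i x r) = ereal z"
proof -
  have lt: "F s < F t" if "0 \<le> s" "s < t" "t \<le> 1" for s t
    using strict that by (auto simp: strict_mono_on_def)
  have le: "F s \<le> F t" if "0 \<le> s" "s \<le> t" "t \<le> 1" for s t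
    using lt[of s t] that by (cases "s = t") auto
  note Icc = interval_valuation_Icc[OF F]
  have "\<not> V i {x..1} < r"
    using Icc[of x 1] z le[of z 1] V by simp
  moreover have "(GREATEST t. t \<in> cake \<and> V i {x..t} = r) = z"
  proof (rule Greatest_equality)
    show "z \<in> cake \<and> V i {x..z} = r" using z V Icc[of x z] by (simp add: cake_def)
    show "t \<le> z" if t: "t \<in> cake \<and> V i {x..t} = r" for t
    proof (rule ccontr)
      assume "\<not> t \<le> z"
      then have "z < t" "t \<le> 1" using t by (auto simp: cake_def)
      then show False using t z V Icc[of x t] lt[of z t] by simp
    qed
  qed
  ultimately show ?thesis by simp
qed

text \<open>The run on \<open>V\<close> itself need not be bounded by \<open>k\<close>: in the promise problem \<open>V\<close> is not an
  admissible instance, and only its first \<open>k\<close> queries matter.\<close>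

lemma indistinguishable:
  assumes "\<And>q. legal_query n q \<Longrightarrow>
    \<exists>W. finite W \<and> card W \<le> 2 \<and> (\<forall>\<pi>\<in>Q - W. answer (V' \<pi>) q = answer V q)"
  shows "legal n P \<Longrightarrow> \<exists>W. finite W \<and> card W \<le> 2 * k \<and>
    (\<forall>\<pi>\<in>Q - W. num_queries (V' \<pi>) P \<le> k \<longrightarrow> run (V' \<pi>) P = run V P)"
proof (induction k arbitrary: P)
  case 0
  show ?case by (rule exI[of _ "{}"], cases P) auto
next
  case (Suc k)
  show ?case
  proof (cases P)
    case (Output a)
    then show ?thesis by (intro exI[of _ "{}"]) auto
  next
    case (Ask q c)
    obtain W1 where W1: "finite W1" "card W1 \<le> 2" "\<forall>\<pi>\<in>Q - W1. answer (V' \<pi>) q = answer V q"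
      using assms[of q] Suc.prems Ask by auto
    obtain W2 where W2: "finite W2" "card W2 \<le> 2 * k" "\<forall>\<pi>\<in>Q - W2.
        num_queries (V' \<pi>) (c (answer V q)) \<le> k \<longrightarrow>
        run (V' \<pi>) (c (answer V q)) = run V (c (answer V q))"
      using Suc.IH[of "c (answer V q)"] Suc.prems Ask by auto
    have "card (W1 \<union> W2) \<le> 2 * Suc k"
      using card_Un_le[of W1 W2] W1(2) W2(2) by simp
    then show ?thesis
      using W1 W2 Ask by (intro exI[of _ "W1 \<union> W2"]) auto
  qed
qed

section \<open>A hard instance\<close>

lemma max_min_lipschitz:
  "\<bar>max 0 (min 1 x) - max 0 (min 1 y)\<bar> \<le> \<bar>x - y\<bar>" for x y :: real
  by (auto simp: max_def min_def)

locale hard_instance =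
  fixes m :: nat
  assumes m_pos: "1 \<le> m"
begin

definition N :: real where "N = real m + 1"

text \<open>Small enough for two purposes: \<open>eps * 2 ^ m\<close> stays within the cores where
  \<open>level\<close> is constant, and \<open>2 ^ i * eps * level t\<close> has Lipschitz constant
  at most 1/4 although the bound for \<open>level\<close> itself is
  \<open>4 * N ^ 3\<close>.\<close>

definition eps :: real where "eps = 1 / (16 * N ^ 4 * 2 ^ m)"

text \<open>\<open>set_encode S\<close> is the sum of \<open>2 ^ i\<close> over
  \<open>i \<in> S\<close>. Points of sets of size \<open>k\<close> cluster at or just right of
  \<open>k / N\<close>, and the encoding separates them.\<close>

definition pt :: "nat set \<Rightarrow> real" where
  "pt S = real (card S) / N + eps * real (set_encode S)"

text \<open>A trapezoid with value 1 up to distance \<open>1 / (8 * N)\<close> and 0 from distance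
  \<open>3 / (8 * N)\<close> on.\<close>

definition plateau :: "real \<Rightarrow> real" where
  "plateau t = max 0 (min 1 (3 / 2 - 4 * N * \<bar>t\<bar>))"

text \<open>\<open>level\<close> is \<open>k\<close> around \<open>k / N\<close> and vanishes at the points \<open>(k + 1 / 2) / N\<close>. Hence
  \<open>cdf i (pt S) = card S / N + eps * (set_encode S - card S * 2 ^ i)\<close>, and adding \<open>i\<close> to \<open>S\<close> changes
  this by exactly \<open>1 / N\<close>.\<close>

definition level :: "real \<Rightarrow> real" where
  "level t = (\<Sum>k\<le>m. real k * plateau (t - real k / N))"

definition cdf :: "nat \<Rightarrow> real \<Rightarrow> real" where
  "cdf i t = t - 2 ^ i * eps * level t"

text \<open>Agent \<open>m\<close> must come last: its valuation \<open>closer\<close> is flat on \<open>[k / N, (k + 1 / 2) / N]\<close> for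
  \<open>k < m\<close>, so after any proper subset \<open>S\<close> of the others it is satisfied only beyond
  \<open>(card S + 3 / 2) / N\<close>, and this loss of half a level is never recovered.\<close>

definition knot :: "nat \<Rightarrow> real" where
  "knot k = (if k = m then pt {..<m} else real k / N)"

definition ramp :: "nat \<Rightarrow> real \<Rightarrow> real" where
  "ramp k t = max 0 (min 1 ((t - (real k - 1 / 2) / N) / (knot k - (real k - 1 / 2) / N)))"

definition closer :: "real \<Rightarrow> real" where
  "closer t = (\<Sum>k=1..Suc m. ramp k t) / N"

text \<open>A tent of height \<open>eps / 4\<close> and half-width \<open>eps / 2\<close>. Its slope
  1/2 is below the slope 3/4 guaranteed for \<open>cdf i\<close>, and tents at distinct points are
  disjoint.\<close>

definition bump :: "real \<Rightarrow> real \<Rightarrow> real" where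
  "bump p t = max 0 (eps / 4 - \<bar>t - p\<bar> / 2)"

definition V0 :: "nat \<Rightarrow> real set \<Rightarrow> real" where
  "V0 j = interval_valuation (if j < m then cdf j else closer)"

definition bumped :: "nat \<times> nat set \<Rightarrow> real \<Rightarrow> real" where
  "bumped = (\<lambda>(i, T) t. cdf i t + bump (pt (insert i T)) t)"

definition V1 :: "nat \<times> nat set \<Rightarrow> nat \<Rightarrow> real set \<Rightarrow> real" where
  "V1 \<pi> = V0(fst \<pi> := interval_valuation (bumped \<pi>))"

text \<open>The edges from \<open>T\<close> to \<open>insert i T\<close> in the cube of subsets of
  \<open>{..<m}\<close>; each carries one possible shift.\<close>

definition edges :: "(nat \<times> nat set) set" where
  "edges = (SIGMA i:{..<m}. Pow ({..<m} - {i}))"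

section \<open>Estimates for the constants, the levels and the cut points\<close>

lemma N_ge: "2 \<le> N" "1 \<le> N" "0 < N"
  using m_pos by (auto simp: N_def)

lemma N_real: "N = real (Suc m)"
  by (simp add: N_def)

lemma eps_pos: "0 < eps"
  using N_ge by (simp add: eps_def)

lemma eps_pow_le: "eps * 2 ^ m \<le> 1 / (16 * N)"
proof -
  have "N ^ 1 \<le> N ^ 4" using N_ge by (intro power_increasing) auto
  then have "1 / (16 * N ^ 4) \<le> 1 / (16 * N)" using N_ge by (intro divide_left_mono) auto
  then show ?thesis by (simp add: eps_def)
qed

lemma eps_le: "eps \<le> 1 / (16 * N)"
proof -
  have "eps * 1 \<le> eps * 2 ^ m" using eps_pos by (intro mult_left_mono) auto
  then show ?thesis using eps_pow_le by simp
qed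

lemma eps_le_inverse: "eps \<le> 1 / N"
proof -
  have "1 / (16 * N) \<le> 1 / N" using N_ge by (simp add: field_simps)
  then show ?thesis using eps_le by linarith
qed

lemma slope_le:
  assumes "i \<le> m"
  shows "2 ^ i * eps * (4 * N ^ 3) \<le> 1 / 4"
proof -
  have "(2::real) ^ i \<le> 2 ^ m" using assms by (intro power_increasing) auto
  then have "2 ^ i * eps * (4 * N ^ 3) \<le> 2 ^ m * eps * (4 * N ^ 3)"
    using eps_pos N_ge by (intro mult_right_mono) auto
  also have "\<dots> = 1 / (4 * N)"
    using N_ge by (simp add: eps_def power_numeral_reduce field_simps)
  also have "\<dots> \<le> 1 / 4" using N_ge by (simp add: field_simps)
  finally show ?thesis .
qed

lemma plateau_lipschitz: "\<bar>plateau x - plateau y\<bar> \<le> 4 * N * \<bar>x - y\<bar>"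
proof -
  have "\<bar>plateau x - plateau y\<bar> \<le> \<bar>(3 / 2 - 4 * N * \<bar>x\<bar>) - (3 / 2 - 4 * N * \<bar>y\<bar>)\<bar>"
    unfolding plateau_def by (rule max_min_lipschitz)
  also have "\<dots> = 4 * N * \<bar>\<bar>x\<bar> - \<bar>y\<bar>\<bar>"
    using N_ge by (simp add: abs_mult flip: right_diff_distrib)
  also have "\<dots> \<le> 4 * N * \<bar>x - y\<bar>" using N_ge by (intro mult_left_mono) auto
  finally show ?thesis .
qed

lemma plateau_one: "\<bar>x\<bar> \<le> 1 / (8 * N) \<Longrightarrow> plateau x = 1"
  using N_ge by (auto simp: plateau_def field_simps max_def min_def)

lemma plateau_zero: "3 / (8 * N) \<le> \<bar>x\<bar> \<Longrightarrow> plateau x = 0"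
  using N_ge by (auto simp: plateau_def field_simps max_def min_def)

lemma level_lipschitz: "\<bar>level x - level y\<bar> \<le> 4 * N ^ 3 * \<bar>x - y\<bar>"
proof -
  have "\<bar>level x - level y\<bar>
      = \<bar>\<Sum>k\<le>m. real k * (plateau (x - real k / N) - plateau (y - real k / N))\<bar>"
    by (simp add: level_def sum_subtractf right_diff_distrib)
  also have "\<dots> \<le> (\<Sum>k\<le>m. \<bar>real k * (plateau (x - real k / N) - plateau (y - real k / N))\<bar>)"
    by (rule sum_abs)
  also have "\<dots> \<le> (\<Sum>k\<le>m. N * (4 * N * \<bar>x - y\<bar>))"
  proof (rule sum_mono)
    fix k assume "k \<in> {..m}"
    then have "real k \<le> N" by (simp add: N_def)
    moreover have "\<bar>plateau (x - real k / N) - plateau (y - real k / N)\<bar> \<le> 4 * N * \<bar>x - y\<bar>"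
      using plateau_lipschitz[of "x - real k / N" "y - real k / N"] by simp
    ultimately show "\<bar>real k * (plateau (x - real k / N) - plateau (y - real k / N))\<bar>
        \<le> N * (4 * N * \<bar>x - y\<bar>)"
      using N_ge by (auto simp: abs_mult intro!: mult_mono)
  qed
  also have "\<dots> = 4 * N ^ 3 * \<bar>x - y\<bar>"
    by (simp add: N_def power_numeral_reduce algebra_simps)
  finally show ?thesis .
qed

lemma level_core:
  assumes k: "k \<le> m" and t: "\<bar>t - real k / N\<bar> \<le> 1 / (8 * N)"
  shows "level t = real k"
proof -
  have "plateau (t - real j / N) = (if j = k then 1 else 0)" for j
  proof (cases "j = k")
    case True
    then show ?thesis using plateau_one[OF t] by simp
  next
    case False
    then have "1 \<le> \<bar>real j - real k\<bar>" by linarith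
    then have "1 / N \<le> \<bar>real j - real k\<bar> / N" using N_ge by (intro divide_right_mono) auto
    also have "\<dots> = \<bar>real j / N - real k / N\<bar>"
      using N_ge by (simp add: abs_divide flip: diff_divide_distrib)
    finally have "1 / N - 1 / (8 * N) \<le> \<bar>t - real j / N\<bar>" using t by linarith
    moreover have "3 / (8 * N) \<le> 1 / N - 1 / (8 * N)" using N_ge by (simp add: field_simps)
    ultimately show ?thesis using plateau_zero[of "t - real j / N"] False by simp
  qed
  then have "level t = (\<Sum>j\<le>m. if j = k then real k else 0)"
    unfolding level_def by (intro sum.cong) auto
  then show ?thesis using k by simp
qed

lemma level_zero:
  assumes "\<And>k. k \<le> m \<Longrightarrow> 1 / 2 \<le> \<bar>N * t - real k\<bar>"
  shows "level t = 0"
proof -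
  have "plateau (t - real k / N) = 0" if "k \<le> m" for k
  proof (rule plateau_zero)
    have "\<bar>t - real k / N\<bar> = \<bar>N * t - real k\<bar> / N"
      using N_ge by (simp add: field_simps abs_if)
    moreover have "3 / 8 / N \<le> \<bar>N * t - real k\<bar> / N"
      using assms[OF that] N_ge by (intro divide_right_mono) auto
    ultimately show "3 / (8 * N) \<le> \<bar>t - real k / N\<bar>" by simp
  qed
  then show ?thesis by (simp add: level_def)
qed

lemma level_half: "level ((real k + 1 / 2) / N) = 0"
proof (rule level_zero)
  fix j :: nat
  have "N * ((real k + 1 / 2) / N) - real j = real_of_int (int k - int j) + 1 / 2"
    using N_ge by simp
  moreover have "0 \<le> int k - int j \<or> int k - int j \<le> -1" by linarith
  then have "0 \<le> real_of_int (int k - int j) \<or> real_of_int (int k - int j) \<le> -1" by linarith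
  ultimately show "1 / 2 \<le> \<bar>N * ((real k + 1 / 2) / N) - real j\<bar>"
    by linarith
qed

lemma level_1: "level 1 = 0"
  by (rule level_zero) (simp add: N_def)

lemma level_0: "level 0 = 0"
  using level_core[of 0 0] N_ge by simp

text \<open>By \<open>slope_le\<close> the perturbation of the identity has Lipschitz constant at
  most 1/4. What remains still exceeds the slope of \<open>bump\<close>.\<close>

lemma cdf_gap:
  assumes "i < m" "x \<le> y"
  shows "3 / 4 * (y - x) \<le> cdf i y - cdf i x"
proof -
  have "2 ^ i * eps * (level y - level x) \<le> 2 ^ i * eps * (4 * N ^ 3 * (y - x))"
    using level_lipschitz[of y x] eps_pos assms(2) by (intro mult_left_mono) auto
  also have "\<dots> = 2 ^ i * eps * (4 * N ^ 3) * (y - x)" by simp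
  also have "\<dots> \<le> 1 / 4 * (y - x)"
    using slope_le[of i] assms by (intro mult_right_mono) auto
  finally have "2 ^ i * eps * (level y - level x) \<le> 1 / 4 * (y - x)" .
  moreover have "cdf i y - cdf i x = (y - x) - 2 ^ i * eps * (level y - level x)"
    by (simp add: cdf_def right_diff_distrib)
  ultimately show ?thesis by argo
qed

lemma bump_lipschitz: "\<bar>bump p x - bump p y\<bar> \<le> \<bar>x - y\<bar> / 2"
  by (auto simp: bump_def max_def abs_if field_simps)

lemma bump_zero: "eps / 2 \<le> \<bar>t - p\<bar> \<Longrightarrow> bump p t = 0"
  by (simp add: bump_def)

lemma pt_bounds:
  assumes "S \<subseteq> {..<m}"
  shows "real (card S) / N \<le> pt S" "pt S \<le> real (card S) / N + 1 / (16 * N)"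
    "real (card S) \<le> real m"
proof -
  have "real (set_encode S) \<le> 2 ^ m"
    using set_encode_less[OF assms] by (metis less_imp_le of_nat_le_iff of_nat_numeral of_nat_power)
  then have "eps * real (set_encode S) \<le> eps * 2 ^ m" using eps_pos by (intro mult_left_mono) auto
  then show "pt S \<le> real (card S) / N + 1 / (16 * N)" using eps_pow_le by (simp add: pt_def)
  show "real (card S) / N \<le> pt S" using eps_pos by (simp add: pt_def)
  show "real (card S) \<le> real m" using card_mono[OF _ assms] by simp
qed

lemma pt_le_1:
  assumes "S \<subseteq> {..<m}" "d \<le> eps"
  shows "pt S + d < 1"
proof -
  have "real (card S) / N \<le> real m / N" using pt_bounds(3)[OF assms(1)] N_ge by (intro divide_right_mono) auto
  then have "pt S + d \<le> real m / N + 1 / (16 * N) + 1 / (16 * N)"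
    using pt_bounds(2)[OF assms(1)] assms(2) eps_le by linarith
  also have "\<dots> < real m / N + 1 / N" using N_ge by (simp add: field_simps)
  also have "\<dots> = 1" using N_ge by (simp add: N_def flip: add_divide_distrib)
  finally show ?thesis .
qed

lemma pt_ge:
  assumes "S \<subseteq> {..<m}" "S \<noteq> {}"
  shows "1 / N \<le> pt S"
proof -
  have "finite S" using assms finite_subset by blast
  then have "1 \<le> card S" using assms by (simp add: Suc_le_eq card_gt_0_iff)
  then have "1 / N \<le> real (card S) / N" using N_ge by (intro divide_right_mono) auto
  then show ?thesis using pt_bounds(1)[OF assms(1)] by simp
qed

lemma pt_empty: "pt {} = 0"
  by (simp add: pt_def)

text \<open>The offset of \<open>pt S\<close> from the grid and the deviation \<open>d\<close> are
  each at most \<open>1 / (16 * N)\<close>, so the point stays in the core of its level.\<close>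

lemma cdf_pt:
  assumes "S \<subseteq> {..<m}" "\<bar>d\<bar> \<le> eps"
  shows "cdf i (pt S + d) = pt S + d - 2 ^ i * eps * real (card S)"
proof -
  have "\<bar>pt S + d - real (card S) / N\<bar> \<le> 1 / (16 * N) + 1 / (16 * N)"
    using pt_bounds[OF assms(1)] eps_le assms(2) by linarith
  also have "\<dots> = 1 / (8 * N)" by simp
  finally have "level (pt S + d) = real (card S)"
    using pt_bounds(3)[OF assms(1)] by (intro level_core) auto
  then show ?thesis by (simp add: cdf_def)
qed

lemma pt_insert:
  assumes "S \<subseteq> {..<m}" "i \<notin> S"
  shows "pt (insert i S) = pt S + 1 / N + eps * 2 ^ i"
proof -
  have "finite S" using assms finite_subset by blast
  then show ?thesis using assms by (simp add: pt_def set_encode_insert add_divide_distrib algebra_simps)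
qed

text \<open>Adding \<open>i\<close> displaces the point by \<open>eps * 2 ^ i\<close> beyond
  \<open>1 / N\<close>, and raising the level by one subtracts exactly that amount. The deviations
  allow for perturbed cuts.\<close>

lemma cdf_step:
  assumes "S \<subseteq> {..<m}" "i < m" "i \<notin> S" "\<bar>d\<bar> \<le> eps" "\<bar>d'\<bar> \<le> eps"
  shows "cdf i (pt (insert i S) + d') = cdf i (pt S + d) + 1 / N + d' - d"
proof -
  have "finite S" using assms finite_subset by blast
  then have "cdf i (pt (insert i S) + d') = pt (insert i S) + d' - 2 ^ i * eps * (real (card S) + 1)"
    using assms cdf_pt[of "insert i S" d' i] by simp
  then show ?thesis
    using cdf_pt[OF assms(1) assms(4), of i] pt_insert[OF assms(1,3)] by (simp add: algebra_simps)
qed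

text \<open>Sets of equal size have different integer encodings. Clusters of different sizes are
  \<open>1 / N\<close> apart up to much smaller offsets.\<close>

lemma pt_separated:
  assumes S: "S \<subseteq> {..<m}" and T: "T \<subseteq> {..<m}" and ne: "S \<noteq> T"
  shows "eps \<le> \<bar>pt S - pt T\<bar>"
proof (cases "card S = card T")
  case True
  have "finite S" "finite T" using S T finite_subset by blast+
  then have "set_encode S \<noteq> set_encode T" using ne set_encode_eq by blast
  then have "1 \<le> \<bar>real (set_encode S) - real (set_encode T)\<bar>" by linarith
  then have "eps * 1 \<le> eps * \<bar>real (set_encode S) - real (set_encode T)\<bar>"
    using eps_pos by (intro mult_left_mono) auto
  also have "\<dots> = \<bar>pt S - pt T\<bar>"
    using True eps_pos by (simp add: pt_def abs_mult flip: right_diff_distrib)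
  finally show ?thesis by simp
next
  case False
  then have "1 \<le> \<bar>real (card S) - real (card T)\<bar>" by linarith
  then have "1 / N \<le> \<bar>real (card S) - real (card T)\<bar> / N" using N_ge by (intro divide_right_mono) auto
  also have "\<dots> = \<bar>real (card S) / N - real (card T) / N\<bar>"
    using N_ge by (simp add: abs_divide flip: diff_divide_distrib)
  finally have "1 / N - 1 / (16 * N) \<le> \<bar>pt S - pt T\<bar>"
    using pt_bounds[OF S] pt_bounds[OF T] by linarith
  moreover have "1 / (16 * N) \<le> 1 / N - 1 / (16 * N)" using N_ge by (simp add: field_simps)
  ultimately show ?thesis using eps_le by linarith
qed

lemma ramp_bounds: "0 \<le> ramp k t" "ramp k t \<le> 1"
  by (auto simp: ramp_def)

lemma knot_gt: "(real k - 1 / 2) / N < knot k"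
proof -
  have "(real k - 1 / 2) / N < real k / N" using N_ge by (intro divide_strict_right_mono) auto
  also have "\<dots> \<le> knot k" using pt_bounds(1)[of "{..<m}"] by (simp add: knot_def)
  finally show ?thesis .
qed

lemma ramp_one: "knot k \<le> t \<Longrightarrow> ramp k t = 1"
  using knot_gt[of k] by (auto simp: ramp_def)

lemma ramp_zero: "t \<le> (real k - 1 / 2) / N \<Longrightarrow> ramp k t = 0"
  using knot_gt[of k] by (simp add: ramp_def divide_nonpos_pos)

lemma ramp_less_one:
  assumes "t < knot k"
  shows "ramp k t < 1"
proof -
  have "(t - (real k - 1 / 2) / N) / (knot k - (real k - 1 / 2) / N) < 1"
    using knot_gt[of k] assms by (subst divide_less_eq_1_pos) linarith+
  then show ?thesis by (auto simp: ramp_def)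
qed

lemma ramp_mono: "s \<le> t \<Longrightarrow> ramp k s \<le> ramp k t"
  unfolding ramp_def using knot_gt[of k]
  by (intro max.mono min.mono order.refl divide_right_mono) auto

lemma closer_ge:
  assumes "k \<le> Suc m" "\<And>j. 1 \<le> j \<Longrightarrow> j \<le> k \<Longrightarrow> knot j \<le> t"
  shows "real k / N \<le> closer t"
proof -
  have "real k = (\<Sum>j=1..k. ramp j t)" using assms by (simp add: ramp_one)
  also have "\<dots> \<le> (\<Sum>j=1..Suc m. ramp j t)"
    using assms ramp_bounds by (intro sum_mono2) auto
  finally show ?thesis unfolding closer_def using N_ge by (intro divide_right_mono) auto
qed

lemma closer_eq:
  assumes "k \<le> Suc m" "t \<le> (real k + 1 / 2) / N"
  shows "closer t = (\<Sum>j=1..k. ramp j t) / N"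
proof -
  have "ramp j t = 0" if "k < j" for j
  proof (rule ramp_zero)
    have "(real k + 1 / 2) / N \<le> (real j - 1 / 2) / N"
      using that N_ge by (intro divide_right_mono) auto
    then show "t \<le> (real j - 1 / 2) / N" using assms by linarith
  qed
  then have "(\<Sum>j=1..Suc m. ramp j t) = (\<Sum>j=1..k. ramp j t)"
    using assms by (intro sum.mono_neutral_right) auto
  then show ?thesis by (simp add: closer_def)
qed

lemma closer_le:
  assumes "k \<le> Suc m" "t \<le> (real k + 1 / 2) / N"
  shows "closer t \<le> real k / N"
proof -
  have "(\<Sum>j=1..k. ramp j t) \<le> (\<Sum>j=1..k. 1)" by (intro sum_mono) (simp add: ramp_bounds)
  then show ?thesis unfolding closer_eq[OF assms] using N_ge by (intro divide_right_mono) auto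
qed

text \<open>Ramp \<open>m\<close> is completed exactly at \<open>knot m = pt {..<m}\<close>. Any cut
  left of that point therefore leaves agent \<open>m\<close> more than \<open>1 / N\<close>.\<close>

lemma closer_less:
  assumes "t < pt {..<m}"
  shows "closer t < real m / N"
proof -
  have "pt {..<m} \<le> (real m + 1 / 2) / N"
    using pt_bounds(2)[of "{..<m}"] N_ge by (simp add: field_simps)
  then have eq: "closer t = (\<Sum>j=1..m. ramp j t) / N" using assms by (intro closer_eq) auto
  have "(\<Sum>j=1..m. ramp j t) < (\<Sum>j=1..m. 1)"
    using assms m_pos ramp_bounds by (intro sum_strict_mono_ex1) (auto intro!: bexI[of _ m] ramp_less_one simp: knot_def)
  then show ?thesis unfolding eq using N_ge by (intro divide_strict_right_mono) auto
qed

lemma knot_le_1: "k \<le> Suc m \<Longrightarrow> knot k \<le> 1"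
  using pt_le_1[of "{..<m}" 0] eps_pos N_ge by (auto simp: knot_def N_def field_simps)

lemma distribution_closer: "distribution closer"
  unfolding distribution_def
proof (intro conjI)
  have "continuous_on {0..1} (ramp k)" for k
    unfolding ramp_def using knot_gt[of k] by (intro continuous_intros) auto
  then show "continuous_on {0..1} closer"
    unfolding closer_def using N_ge by (intro continuous_intros) auto
  show "mono_on {0..1} closer"
    unfolding closer_def using N_ge
    by (intro monotone_onI divide_right_mono sum_mono ramp_mono) auto
  show "closer 0 = 0" using closer_eq[of 0 0] N_ge by simp
  have "real (Suc m) / N \<le> closer 1" by (intro closer_ge knot_le_1) auto
  moreover have "closer 1 \<le> real (Suc m) / N"
    using N_ge by (intro closer_le) (auto simp: N_def field_simps)
  ultimately show "closer 1 = 1" using N_ge by (simp add: N_real)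
qed

lemma continuous_cdf: "continuous_on A (cdf i)"
proof -
  have "continuous_on A (\<lambda>t. plateau (t - a))" for a
    unfolding plateau_def by (intro continuous_intros)
  then show ?thesis unfolding cdf_def level_def by (intro continuous_intros)
qed

lemma distribution_cdf:
  assumes "i < m"
  shows "distribution (cdf i)" "strict_mono_on {0..1} (cdf i)"
proof -
  show strict: "strict_mono_on {0..1} (cdf i)"
    unfolding strict_mono_on_def
  proof (clarsimp)
    fix x y :: real assume "x < y"
    then show "cdf i x < cdf i y" using cdf_gap[OF assms, of x y] by (simp add: field_simps)
  qed
  show "distribution (cdf i)"
    unfolding distribution_def using strict continuous_cdf
    by (auto simp: strict_mono_on_imp_mono_on cdf_def level_0 level_1)
qed

text \<open>The slope 3/4 absorbs the slope 1/2 of the bump, and both ends of the cake lie outside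
  the bump.\<close>

lemma bumped_props:
  assumes "\<pi> \<in> edges"
  shows "distribution (bumped \<pi>)" "strict_mono_on {0..1} (bumped \<pi>)"
proof -
  obtain i T where pi: "\<pi> = (i, T)" by (cases \<pi>)
  then have i: "i < m" "insert i T \<subseteq> {..<m}" using assms by (auto simp: edges_def)
  let ?p = "pt (insert i T)"
  show strict: "strict_mono_on {0..1} (bumped \<pi>)"
    unfolding strict_mono_on_def pi bumped_def
  proof (clarsimp)
    fix x y :: real assume "x < y"
    then show "cdf i x + bump ?p x < cdf i y + bump ?p y"
      using cdf_gap[OF i(1) less_imp_le[OF \<open>x < y\<close>]] bump_lipschitz[of ?p x y] by argo
  qed
  have "eps / 2 \<le> \<bar>0 - ?p\<bar>"
    using pt_ge[OF i(2)] eps_le_inverse eps_pos by simp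
  moreover have "eps / 2 \<le> \<bar>1 - ?p\<bar>"
    using pt_le_1[OF i(2), of eps] eps_pos by simp
  moreover have "continuous_on {0..1} (bumped \<pi>)"
    unfolding bumped_def pi bump_def by (simp, intro continuous_intros continuous_cdf) simp
  ultimately show "distribution (bumped \<pi>)"
    unfolding distribution_def using strict distribution_cdf(1)[OF i(1)]
    by (auto simp: strict_mono_on_imp_mono_on bumped_def pi bump_zero distribution_def)
qed

section \<open>The unshifted instance has no allocation\<close>

abbreviation w where "w \<equiv> equal_entitlements (Suc m)"

lemma w_eq: "w i = 1 / N"
  by (simp add: equal_entitlements_def N_def add.commute)

lemma V0_profiles: "V0 \<in> profiles (Suc m)"
  using distribution_cdf distribution_closer
  by (auto simp: profiles_def V0_def intro!: valuation_interval_valuation)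

lemma V1_profiles: "\<pi> \<in> edges \<Longrightarrow> V1 \<pi> \<in> profiles (Suc m)"
  using V0_profiles valuation_interval_valuation[OF bumped_props(1)]
  by (simp add: profiles_def V1_def)

lemma V0_Icc:
  assumes "0 \<le> x" "x \<le> y" "y \<le> 1"
  shows "j < m \<Longrightarrow> V0 j {x..y} = cdf j y - cdf j x" "V0 m {x..y} = closer y - closer x"
  using interval_valuation_Icc[OF _ assms] distribution_cdf distribution_closer
  by (auto simp: V0_def)

lemma V0_cdf:
  assumes "0 \<le> y" "y \<le> 1"
  shows "j < m \<Longrightarrow> V0 j {0..y} = cdf j y" "V0 m {0..y} = closer y"
  using V0_Icc[of 0 y] assms distribution_cdf[of j] distribution_closer
  by (auto simp: distribution_def)

text \<open>Cuts follow \<open>pt\<close> until agent \<open>m\<close> is served and then run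
  through the half levels, where \<open>level\<close> vanishes and every \<open>cdf i\<close> is the
  identity. For the full set they are capped at the end of the cake.\<close>

definition barrier :: "nat set \<Rightarrow> real" where
  "barrier T = (if T = {..<Suc m} then 1 else if m \<in> T then (real (card T) + 1 / 2) / N else pt T)"

lemma subset_cases:
  assumes "T \<subseteq> {..<Suc m}" "m \<notin> T"
  shows "T \<subseteq> {..<m}"
proof
  fix x assume "x \<in> T"
  then have "x < Suc m" "x \<noteq> m" using assms by auto
  then show "x \<in> {..<m}" by simp
qed

lemma card_proper:
  assumes "T \<subseteq> {..<k}" "T \<noteq> {..<k}"
  shows "card T < k"
  using psubset_card_mono[of "{..<k}" T] assms by auto

lemma half_le_1: "k \<le> m \<Longrightarrow> (real k + 1 / 2) / N \<le> 1"
  using N_ge by (simp add: N_def field_simps)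

lemma barrier_cake:
  assumes "T \<subseteq> {..<Suc m}"
  shows "barrier T \<in> {0..1}"
proof -
  consider "T = {..<Suc m}" | "T \<noteq> {..<Suc m}" "m \<in> T" | "T \<noteq> {..<Suc m}" "m \<notin> T" by blast
  then show ?thesis
  proof cases
    case 2
    then have "card T \<le> m" using card_proper[OF assms] by simp
    then show ?thesis using 2 half_le_1 N_ge by (simp add: barrier_def)
  next
    case 3
    then have T: "T \<subseteq> {..<m}" using subset_cases assms by blast
    have "0 \<le> real (card T) / N" using N_ge by simp
    then have "0 \<le> pt T" using pt_bounds(1)[OF T] by linarith
    then show ?thesis using 3 pt_le_1[OF T, of 0] eps_pos by (simp add: barrier_def)
  qed (simp add: barrier_def)
qed

lemma cdf_half: "cdf i ((real k + 1 / 2) / N) = (real k + 1 / 2) / N"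
  by (simp add: cdf_def level_half)

lemma closer_pt:
  assumes "T \<subseteq> {..<m}"
  shows "real (card T) / N \<le> closer (pt T)"
proof (rule closer_ge)
  show "card T \<le> Suc m" using pt_bounds(3)[OF assms] by simp
  fix j assume j: "1 \<le> j" "j \<le> card T"
  show "knot j \<le> pt T"
  proof (cases "j = m")
    case True
    then have "T = {..<m}" using card_proper[OF assms] j by fastforce
    then show ?thesis using True by (simp add: knot_def)
  next
    case False
    have "real j / N \<le> real (card T) / N" using j N_ge by (intro divide_right_mono) auto
    then show ?thesis using False pt_bounds(1)[OF assms] by (simp add: knot_def)
  qed
qed

lemma barrier_step:
  assumes T: "T \<subseteq> {..<Suc m}" and i: "i < Suc m" "i \<notin> T"
  shows "V0 i {0..barrier (insert i T)} \<le> V0 i {0..barrier T} + w i"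
proof -
  have c1: "barrier T \<in> {0..1}" and c2: "barrier (insert i T) \<in> {0..1}"
    using T i by (intro barrier_cake; simp)+
  have fin: "finite T" using T finite_subset by blast
  have Tne: "T \<noteq> {..<Suc m}" using i by auto
  show ?thesis
  proof (cases "i = m")
    case True
    then have Tm: "T \<subseteq> {..<m}" and mT: "m \<notin> T" using subset_cases T i by auto
    then have bT: "barrier T = pt T" using Tne by (simp add: barrier_def)
    have "closer (barrier (insert m T)) \<le> closer (pt T) + 1 / N"
    proof (cases "insert m T = {..<Suc m}")
      case True
      then have "card (insert m T) = Suc m" by simp
      then have "card T = m" using mT fin by simp
      then have "T = {..<m}" using card_subset_eq[OF _ Tm] by simp
      then have "real m / N \<le> closer (pt T)" using closer_pt[OF Tm] by simp
      moreover have "real m / N + 1 / N = 1" using N_ge by (simp add: N_def flip: add_divide_distrib)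
      ultimately show ?thesis
        using True distribution_closer by (simp add: barrier_def distribution_def)
    next
      case False
      then have "T \<noteq> {..<m}" by (auto simp: lessThan_Suc)
      then have c: "card T < m" using card_proper[OF Tm] by simp
      \<comment> \<open>No ramp beyond number \<open>card T + 1\<close> starts before the next half
        level, so the cut can be pushed that far.\<close>
      have "closer (barrier (insert m T)) \<le> real (card T + 1) / N"
        using False mT fin c by (intro closer_le) (auto simp: barrier_def)
      also have "\<dots> = real (card T) / N + 1 / N" by (simp add: add_divide_distrib)
      finally show ?thesis using closer_pt[OF Tm] by linarith
    qed
    then show ?thesis using True c1 c2 V0_cdf(2) bT by (simp add: w_eq)
  next
    case False
    then have im: "i < m" using i by simp
    have "cdf i (barrier (insert i T)) \<le> cdf i (barrier T) + 1 / N"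
    proof (cases "m \<in> T")
      case False
      then have Tm: "T \<subseteq> {..<m}" using subset_cases T by blast
      moreover have "m \<notin> insert i T" using False im by simp
      ultimately show ?thesis
        using False cdf_step[OF Tm im i(2), of 0 0] eps_pos Tne by (auto simp: barrier_def)
    next
      case True
      then have bT: "barrier T = (real (card T) + 1 / 2) / N" using Tne by (simp add: barrier_def)
      show ?thesis
      proof (cases "insert i T = {..<Suc m}")
        case True
        then have "card (insert i T) = Suc m" by simp
        then have "card T = m" using fin i by simp
        \<comment> \<open>The half level lost to agent \<open>m\<close> leaves only
          \<open>(1 / 2) / N\<close> of the cake for the last agent.\<close>
        then have "1 \<le> barrier T + 1 / N" using bT N_ge by (simp add: N_def field_simps)
        then show ?thesis using True bT cdf_half distribution_cdf(1)[OF im]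
          by (simp add: barrier_def distribution_def)
      next
        case False
        then have b: "barrier (insert i T) = (real (card T + 1) + 1 / 2) / N"
          using True fin i by (simp add: barrier_def)
        have "(real (card T + 1) + 1 / 2) / N = (real (card T) + 1 / 2) / N + 1 / N"
          using N_ge by (simp add: field_simps)
        then show ?thesis unfolding b bT cdf_half by simp
      qed
    qed
    then show ?thesis using im c1 c2 V0_cdf(1) by (simp add: w_eq)
  qed
qed

lemma no_csp_V0: "\<not> csp (Suc m) w V0 X"
proof (rule no_csp_barrier[OF V0_profiles, where B = barrier])
  show "barrier {} = 0" by (auto simp: barrier_def pt_empty lessThan_Suc)
qed (use barrier_cake barrier_step in \<open>auto simp: w_eq N_ge barrier_def\<close>)

section \<open>Allocations after one shift\<close>

text \<open>An agent without a bump is satisfied as soon as the deviation from \<open>pt\<close>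
  grows along its piece; the growth is exactly its surplus.\<close>

lemma V1_piece:
  assumes S: "S \<subseteq> {..<m}" and j: "j < m" "j \<notin> S" "j \<noteq> fst \<pi>"
    and d: "\<bar>d\<bar> \<le> eps" "\<bar>d'\<bar> \<le> eps" "d < d'" "0 \<le> pt S + d"
  shows "pt S + d < pt (insert j S) + d'"
    "w j < V1 \<pi> j {pt S + d..pt (insert j S) + d'}"
proof -
  have le1: "pt (insert j S) + d' \<le> 1"
    using pt_le_1[of "insert j S" d'] S j d(2) by (simp add: abs_le_iff)
  show lt: "pt S + d < pt (insert j S) + d'"
    using pt_insert[OF S j(2)] d N_ge eps_pos by (simp add: add_pos_pos add_strict_mono)
  have "V1 \<pi> j = V0 j" using j by (simp add: V1_def)
  then show "w j < V1 \<pi> j {pt S + d..pt (insert j S) + d'}"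
    using V0_Icc(1)[OF d(4) less_imp_le[OF lt] le1 j(1)] cdf_step[OF S j(1,2) d(1,2)] d(3) by (simp add: w_eq)
qed

text \<open>The agents are served along a chain from \<open>{}\<close> through \<open>T\<close> and
  \<open>insert i T\<close> to \<open>{..<m}\<close>, with agent \<open>m\<close> last. Deviations
  from \<open>pt\<close> grow slightly at each step; only the bump lets them fall, from nonnegative
  at \<open>T\<close> to negative at \<open>insert i T\<close>. They are still negative at
  \<open>{..<m}\<close>, which satisfies agent \<open>m\<close> by
  \<open>closer_less\<close>.\<close>

lemma csp_V1:
  assumes "\<pi> \<in> edges"
  shows "\<exists>X. csp (Suc m) w (V1 \<pi>) X"
proof -
  obtain i T where pi: "\<pi> = (i, T)" by (cases \<pi>)
  then have i: "i < m" and T: "T \<subseteq> {..<m}" "i \<notin> T" using assms by (auto simp: edges_def)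
  have finT: "finite T" using T finite_subset by blast
  \<comment> \<open>All deviations then stay within \<open>eps / 20\<close>, so their fall costs
    less than the bump of about \<open>eps / 4\<close> brings.\<close>
  define eta where "eta = eps / (20 * N)"
  have eta: "0 < eta" using eps_pos N_ge by (simp add: eta_def)
  have eta_le: "real k * eta \<le> eps / 20" if "k \<le> Suc m" for k
  proof -
    have "real k * eta \<le> N * eta" using that eta by (intro mult_right_mono) (auto simp: N_def)
    also have "\<dots> = eps / 20" using N_ge by (simp add: eta_def)
    finally show ?thesis .
  qed
  have nn: "0 \<le> real k * eta" for k using eta by simp
  have pt0: "0 \<le> pt S" if "S \<subseteq> {..<m}" for S
    using that eps_pos N_ge by (simp add: pt_def)
  have A: "\<exists>X. tiled (V1 \<pi>) w U (pt U + real (card U) * eta) X" if "U \<subseteq> T" for U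
  proof -
    have "finite U" using that finT finite_subset by blast
    then show ?thesis using that
    proof (induction U)
      case empty
      then show ?case by (auto simp: pt_empty intro: tiled_empty)
    next
      case (insert j U)
      then obtain X where X: "tiled (V1 \<pi>) w U (pt U + real (card U) * eta) X" by auto
      have U: "U \<subseteq> {..<m}" "j < m" "j \<noteq> i" using insert T by auto
      have cU: "card U < m" using card_proper[OF U(1)] U(2) insert.hyps by auto
      have ci: "real (card (insert j U)) * eta = real (card U) * eta + eta"
        using insert.hyps by (simp add: algebra_simps)
      have b: "\<bar>real (card U) * eta\<bar> \<le> eps" "\<bar>real (card U) * eta + eta\<bar> \<le> eps"
        using eta_le[of "card U"] eta_le[of "Suc (card U)"] nn[of "card U"] eta eps_pos cU
        by (auto simp: algebra_simps)
      have "0 \<le> pt U + real (card U) * eta" using pt0[OF U(1)] nn[of "card U"] by simp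
      note p = V1_piece[OF U(1,2) insert.hyps(2) _ b _ this, of \<pi>]
      show ?case
        using tiled_insert[OF X insert.hyps(2) p] eta U pi unfolding ci by auto
    qed
  qed
  obtain XA where XA: "tiled (V1 \<pi>) w T (pt T + real (card T) * eta) XA" using A by blast
  let ?S = "insert i T"
  have S: "?S \<subseteq> {..<m}" using T i by auto
  have cT: "card T < m" using card_proper[OF T(1)] T(2) i by auto
  \<comment> \<open>The \<open>+ 1\<close> keeps a gap of \<open>eta\<close> at
    \<open>{..<m}\<close>; each agent added after \<open>i\<close> reduces the gap by
    \<open>eta\<close>.\<close>
  define gap where "gap U = (real m - real (card U) + 1) * eta" for U :: "nat set"
  have gap: "0 < gap U" "gap U \<le> eps / 20" if "U \<subseteq> {..<m}" for U
  proof -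
    have c: "card U \<le> m" using pt_bounds(3)[OF that] by simp
    then show "0 < gap U" using eta by (simp add: gap_def)
    have "gap U = real (m - card U + 1) * eta" using c by (simp add: gap_def of_nat_diff)
    also have "\<dots> \<le> eps / 20" by (rule eta_le) simp
    finally show "gap U \<le> eps / 20" .
  qed
  have gapS: "pt U + - gap U < 1 \<and> 0 \<le> pt U + - gap U" if "U \<subseteq> {..<m}" "U \<noteq> {}" for U
    using gap[OF that(1)] pt_ge[OF that] eps_le_inverse eps_pos pt_le_1[OF that(1), of 0] by auto
  have B: "tiled (V1 \<pi>) w ?S (pt ?S + - gap ?S) (XA(i := {pt T + real (card T) * eta..pt ?S + - gap ?S}))"
  proof (rule tiled_insert[OF XA T(2)])
    let ?y = "pt T + real (card T) * eta" and ?z = "pt ?S + - gap ?S"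
    have ye: "\<bar>real (card T) * eta\<bar> \<le> eps" "0 \<le> real (card T) * eta" "real (card T) * eta \<le> eps / 20"
      using eta_le[of "card T"] nn[of "card T"] eps_pos cT by auto
    have ze: "\<bar>- gap ?S\<bar> \<le> eps" using gap[OF S] eps_pos by simp
    \<comment> \<open>The left cut misses the bump, so only the right cut gains from it.\<close>
    have far: "?y + eps / 2 \<le> pt ?S"
    proof -
      have "0 \<le> eps * 2 ^ i" using eps_pos by simp
      then show ?thesis using pt_insert[OF T] ye eps_le_inverse eps_pos by linarith
    qed
    then show lt: "?y < ?z" using gap[OF S] eps_pos by linarith
    have y0: "0 \<le> ?y" using pt0[OF T(1)] ye by simp
    have z1: "?z \<le> 1" using gapS[OF S] by simp
    have "V1 \<pi> i = interval_valuation (bumped \<pi>)" using pi by (simp add: V1_def)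
    then have "V1 \<pi> i {?y..?z} = bumped \<pi> ?z - bumped \<pi> ?y"
      using interval_valuation_Icc[OF bumped_props(1)[OF assms] y0 less_imp_le[OF lt] z1] by simp
    also have "bumped \<pi> ?y = cdf i ?y"
      using far eps_pos by (simp add: pi bumped_def bump_zero)
    also have "bumped \<pi> ?z = cdf i ?z + bump (pt ?S) ?z" by (simp add: pi bumped_def)
    also have "cdf i ?z = cdf i ?y + 1 / N + - gap ?S - real (card T) * eta"
      using cdf_step[OF T(1) i T(2) ye(1) ze] by simp
    finally have "V1 \<pi> i {?y..?z} = 1 / N - gap ?S - real (card T) * eta + bump (pt ?S) ?z" by simp
    moreover have "eps / 4 - gap ?S / 2 \<le> bump (pt ?S) ?z"
      using gap[OF S] by (simp add: bump_def)
    ultimately show "w i < V1 \<pi> i {?y..?z}"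
      using gap[OF S] ye eps_pos by (simp add: w_eq)
  qed
  have C: "\<exists>X. tiled (V1 \<pi>) w (U \<union> ?S) (pt (U \<union> ?S) + - gap (U \<union> ?S)) X" if "U \<subseteq> {..<m} - ?S" for U
  proof -
    have "finite U" using that finite_subset by blast
    then show ?thesis using that
    proof (induction U)
      case empty
      then show ?case using B by auto
    next
      case (insert j U)
      let ?U = "U \<union> ?S"
      obtain X where X: "tiled (V1 \<pi>) w ?U (pt ?U + - gap ?U) X" using insert by auto
      have U: "?U \<subseteq> {..<m}" "j < m" "j \<notin> ?U" "j \<noteq> fst \<pi>" using insert S pi by auto
      have jU: "insert j ?U \<subseteq> {..<m}" using U by auto
      have "finite ?U" using finite_subset[OF U(1)] by simp
      then have "gap (insert j ?U) = gap ?U - eta"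
        using U(3) by (simp add: gap_def algebra_simps)
      then have lt: "- gap ?U < - gap (insert j ?U)" using eta by simp
      have b: "\<bar>- gap ?U\<bar> \<le> eps" "\<bar>- gap (insert j ?U)\<bar> \<le> eps"
        using gap[OF U(1)] gap[OF jU] eps_pos by auto
      have "0 \<le> pt ?U + - gap ?U" using gapS[OF U(1)] by auto
      note p = V1_piece[OF U b lt this]
      show ?case unfolding Un_insert_left using tiled_insert[OF X U(3) p] by blast
    qed
  qed
  have Un: "({..<m} - ?S) \<union> ?S = {..<m}" using S by auto
  obtain X where X: "tiled (V1 \<pi>) w {..<m} (pt {..<m} + - gap {..<m}) X"
    using C[of "{..<m} - ?S", unfolded Un] by blast
  have ne: "{..<m} \<noteq> {}" using i by auto
  have g: "pt {..<m} + - gap {..<m} < 1" "0 \<le> pt {..<m} + - gap {..<m}" using gapS[OF _ ne] by auto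
  have "V1 \<pi> m {pt {..<m} + - gap {..<m}..1} = closer 1 - closer (pt {..<m} + - gap {..<m})"
    using V0_Icc(2)[OF g(2) less_imp_le[OF g(1)]] i pi by (simp add: V1_def)
  moreover have "closer (pt {..<m} + - gap {..<m}) < real m / N"
    using gap[of "{..<m}"] by (intro closer_less) simp
  moreover have "real m / N + 1 / N = 1" using N_ge by (simp add: N_def flip: add_divide_distrib)
  ultimately have "w m < V1 \<pi> m {pt {..<m} + - gap {..<m}..1}"
    using distribution_closer by (simp add: w_eq distribution_def)
  from tiled_insert[OF X _ g(1) this]
  have "tiled (V1 \<pi>) w {..<Suc m} 1 (X(m := {pt {..<m} + - gap {..<m}..1}))"
    by (simp add: lessThan_Suc)
  then show ?thesis using csp_if_tiled by blast
qed

section \<open>Detection of shifts by queries\<close>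

text \<open>The shifts of agent \<open>i\<close> that the value of its distribution function at
  \<open>x\<close> can reveal.\<close>

definition near :: "nat \<Rightarrow> real \<Rightarrow> (nat \<times> nat set) set" where
  "near i x = {\<pi> \<in> edges. fst \<pi> = i \<and> \<bar>x - pt (insert i (snd \<pi>))\<bar> < eps / 2}"

lemma finite_edges: "finite edges"
  by (simp add: edges_def)

lemma card_edges: "card edges = m * 2 ^ (m - 1)"
  by (simp add: edges_def card_Pow)

lemma finite_near: "finite (near i x)"
  using finite_edges by (simp add: near_def)

text \<open>Open neighbourhoods of radius \<open>eps / 2\<close> around points at least
  \<open>eps\<close> apart cannot share \<open>x\<close>, and \<open>T\<close> is recovered from
  \<open>insert i T\<close> because \<open>i \<notin> T\<close>.\<close>

lemma card_near: "card (near i x) \<le> 1"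
proof -
  have "\<pi> = \<rho>" if "\<pi> \<in> near i x" "\<rho> \<in> near i x" for \<pi> \<rho>
  proof -
    have p: "fst \<pi> = i" "fst \<rho> = i" "i \<notin> snd \<pi>" "i \<notin> snd \<rho>"
      "insert i (snd \<pi>) \<subseteq> {..<m}" "insert i (snd \<rho>) \<subseteq> {..<m}"
      "\<bar>x - pt (insert i (snd \<pi>))\<bar> < eps / 2" "\<bar>x - pt (insert i (snd \<rho>))\<bar> < eps / 2"
      using that by (auto simp: near_def edges_def)
    then have "insert i (snd \<pi>) = insert i (snd \<rho>)"
      using pt_separated[OF p(5,6)] by argo
    then have "snd \<pi> = snd \<rho>" using p(3,4) by (simp add: insert_ident)
    then show ?thesis using p(1,2) by (simp add: prod_eq_iff)
  qed
  then show ?thesis using card_le_Suc0_iff_eq[OF finite_near] by simp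
qed

lemma card_near_Un: "finite (near i x \<union> near j y)" "card (near i x \<union> near j y) \<le> 2"
  using card_Un_le[of "near i x" "near j y"] card_near[of i x] card_near[of j y] finite_near
  by auto

lemma near_witness:
  assumes "\<And>\<pi>. \<pi> \<in> edges - (near i x \<union> near j y) \<Longrightarrow> P \<pi>"
  shows "\<exists>W. finite W \<and> card W \<le> 2 \<and> (\<forall>\<pi>\<in>edges - W. P \<pi>)"
  using card_near_Un[of i x j y] assms by (intro exI[of _ "near i x \<union> near j y"]) simp

lemma bumped_far:
  assumes "\<pi> \<in> edges" "\<pi> \<notin> near (fst \<pi>) x"
  shows "bumped \<pi> x = cdf (fst \<pi>) x"
  using assms by (auto simp: near_def bumped_def bump_zero split: prod.split)

lemma V1_Icc:
  assumes "\<pi> \<in> edges" "0 \<le> x" "x \<le> y" "y \<le> 1" "\<pi> \<notin> near i x \<union> near i y"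
  shows "V1 \<pi> i {x..y} = V0 i {x..y}"
proof (cases "fst \<pi> = i")
  case True
  then have "i < m" using assms(1) by (auto simp: edges_def)
  then have "V0 i {x..y} = cdf i y - cdf i x" using V0_Icc(1) assms by blast
  moreover have "V1 \<pi> i {x..y} = bumped \<pi> y - bumped \<pi> x"
    using interval_valuation_Icc[OF bumped_props(1)] assms True by (simp add: V1_def)
  ultimately show ?thesis using bumped_far[OF assms(1)] assms(5) True by auto
qed (simp add: V1_def)

text \<open>An evaluation depends on the function at two points. So does a finite mark
  \<open>z\<close>: if the shift is near neither \<open>x\<close> nor \<open>z\<close>, the shifted
  function still meets the target at \<open>z\<close>, and strictness gives the same answer. An
  infinite mark is decided at \<open>x\<close> and 1. Agent \<open>m\<close> is never
  shifted.\<close>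

lemma answer_V1:
  assumes "legal_query (Suc m) q"
  shows "\<exists>W. finite W \<and> card W \<le> 2 \<and> (\<forall>\<pi>\<in>edges - W. answer (V1 \<pi>) q = answer V0 q)"
proof (cases q)
  case (Eval i x y)
  then have "0 \<le> x" "x \<le> y" "y \<le> 1" using assms by (auto simp: cake_def)
  then have "answer (V1 \<pi>) q = answer V0 q" if "\<pi> \<in> edges - (near i x \<union> near i y)" for \<pi>
    using V1_Icc[of \<pi> x y i] that Eval by simp
  then show ?thesis by (rule near_witness)
next
  case (Mark i x r)
  then have x: "0 \<le> x" "x \<le> 1" and r: "0 \<le> r" using assms by (auto simp: cake_def)
  have other: "answer (V1 \<pi>) q = answer V0 q" if "fst \<pi> \<noteq> i" for \<pi>
    using that Mark by (simp add: V1_def)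
  consider "\<not> i < m" | "i < m" "V0 i {x..1} < r" | "i < m" "r \<le> V0 i {x..1}" by linarith
  then show ?thesis
  proof cases
    case 1
    then have "\<forall>\<pi>\<in>edges - {}. answer (V1 \<pi>) q = answer V0 q"
      using other by (force simp: edges_def)
    then show ?thesis by (intro exI[of _ "{}"]) auto
  next
    case 2
    have "answer (V1 \<pi>) q = answer V0 q" if "\<pi> \<in> edges - (near i x \<union> near i 1)" for \<pi>
      using V1_Icc[of \<pi> x 1 i] that x 2 Mark by simp
    then show ?thesis by (rule near_witness)
  next
    case 3
    have "\<exists>z\<ge>x. z \<le> 1 \<and> cdf i z = cdf i x + r"
      using 3 r x V0_Icc(1)[OF x(1,2) order.refl 3(1)] by (intro IVT' continuous_cdf) auto
    then obtain z where z: "x \<le> z" "z \<le> 1" "cdf i z = cdf i x + r" by blast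
    have a0: "answer V0 q = ereal z"
      unfolding Mark using z x 3 distribution_cdf[OF 3(1)]
      by (intro answer_Mark_strict[where F = "cdf i"]) (auto simp: V0_def)
    have "answer (V1 \<pi>) q = answer V0 q" if pi: "\<pi> \<in> edges - (near i x \<union> near i z)" for \<pi>
    proof (cases "fst \<pi> = i")
      case True
      have "bumped \<pi> x = cdf i x" "bumped \<pi> z = cdf i z"
        using bumped_far[of \<pi>] pi True by auto
      then have "answer (V1 \<pi>) q = ereal z"
        unfolding Mark using z x True pi bumped_props[of \<pi>]
        by (intro answer_Mark_strict[where F = "bumped \<pi>"]) (auto simp: V1_def)
      then show ?thesis using a0 by simp
    qed (rule other)
    then show ?thesis by (rule near_witness)
  qed
qed

text \<open>The outputs on \<open>V0\<close> and on an undetected shift coincide although the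
  correct decisions differ, so every edge must be detected.\<close>

lemma decide_lower:
  assumes P: "legal (Suc m) P" and correct: "\<And>V. V \<in> profiles (Suc m) \<Longrightarrow> run V P \<longleftrightarrow> (\<exists>X. csp (Suc m) w V X)"
    and k: "\<And>V. V \<in> profiles (Suc m) \<Longrightarrow> num_queries V P \<le> k"
  shows "m * 2 ^ (m - 1) \<le> 2 * k"
proof -
  obtain W where W: "finite W" "card W \<le> 2 * k"
    "\<forall>\<pi>\<in>edges - W. num_queries (V1 \<pi>) P \<le> k \<longrightarrow> run (V1 \<pi>) P = run V0 P"
    using indistinguishable[OF answer_V1 P] by blast
  have "\<not> run V0 P" using correct[OF V0_profiles] no_csp_V0 by simp
  moreover have "run (V1 \<pi>) P" if "\<pi> \<in> edges" for \<pi>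
    using correct[OF V1_profiles[OF that]] csp_V1[OF that] by simp
  ultimately have "edges \<subseteq> W" using W(3) k[OF V1_profiles] by auto
  then have "card edges \<le> card W" using W(1) by (intro card_mono)
  then show ?thesis using W(2) by (simp add: card_edges)
qed

lemma compute_promise_lower:
  assumes P: "legal (Suc m) P"
    and correct: "\<And>V. V \<in> profiles (Suc m) \<Longrightarrow> \<exists>X. csp (Suc m) w V X \<Longrightarrow> csp (Suc m) w V (run V P)"
    and k: "\<And>V. V \<in> profiles (Suc m) \<Longrightarrow> \<exists>X. csp (Suc m) w V X \<Longrightarrow> num_queries V P \<le> k"
  shows "m * 2 ^ (m - 1) \<le> 2 * k + 2 * m"
proof -
  obtain W where W: "finite W" "card W \<le> 2 * k"
    "\<forall>\<pi>\<in>edges - W. num_queries (V1 \<pi>) P \<le> k \<longrightarrow> run (V1 \<pi>) P = run V0 P"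
    using indistinguishable[OF answer_V1 P] by blast
  define X where "X = run V0 P"
  \<comment> \<open>The output \<open>X\<close> is arbitrary so far; \<open>Inf\<close> and
    \<open>Sup\<close> stand for the end points that its pieces will turn out to have. An undetected
    shift must be near one of them, since otherwise \<open>X\<close> would also be strongly
    proportional for \<open>V0\<close>.\<close>
  let ?U = "\<Union>i<m. near i (Inf (X i)) \<union> near i (Sup (X i))"
  have "\<pi> \<in> ?U" if pi: "\<pi> \<in> edges" "\<pi> \<notin> W" for \<pi>
  proof (rule ccontr)
    assume far: "\<pi> \<notin> ?U"
    note V1 = V1_profiles[OF pi(1)] and ex = csp_V1[OF pi(1)]
    have "run (V1 \<pi>) P = X" using W(3) k[OF V1 ex] pi by (auto simp: X_def)
    then have csp: "csp (Suc m) w (V1 \<pi>) X" using correct[OF V1 ex] by simp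
    then obtain a b where ab: "\<forall>i<Suc m. X i = {a i..b i} \<and> 0 \<le> a i \<and> a i < b i \<and> b i \<le> 1
        \<and> w i < V1 \<pi> i {a i..b i}"
      using csp_intervals[OF V1 _ csp] by (auto simp: w_eq N_ge)
    have "V1 \<pi> i (X i) = V0 i (X i)" if i: "i < Suc m" for i
    proof (cases "i < m")
      case True
      have X: "X i = {a i..b i}" "0 \<le> a i" "a i < b i" "b i \<le> 1" using ab i by auto
      have "\<pi> \<notin> near i (Inf (X i)) \<union> near i (Sup (X i))" using far True by auto
      then have "\<pi> \<notin> near i (a i) \<union> near i (b i)" using X by simp
      then show ?thesis unfolding X(1) using V1_Icc[OF pi(1)] X by simp
    next
      case False
      then show ?thesis using pi(1) by (auto simp: V1_def edges_def)
    qed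
    then have "csp (Suc m) w V0 X"
      using csp by (simp add: csp_def strongly_proportional_def)
    then show False using no_csp_V0 by blast
  qed
  then have "edges \<subseteq> W \<union> ?U" by blast
  moreover have "finite (W \<union> ?U)" using W(1) finite_near by auto
  ultimately have "card edges \<le> card (W \<union> ?U)" by (intro card_mono)
  also have "\<dots> \<le> card W + card ?U" by (rule card_Un_le)
  also have "card ?U \<le> (\<Sum>i<m. card (near i (Inf (X i)) \<union> near i (Sup (X i))))"
    by (rule card_UN_le) simp
  also have "\<dots> \<le> (\<Sum>i<m. 2)" by (intro sum_mono card_near_Un)
  finally show ?thesis using W(2) by (simp add: card_edges)
qed

end

section \<open>Query complexity\<close>

lemma query_complexity_le:
  assumes "legal n P" "\<And>V. V \<in> \<I> \<Longrightarrow> R V (run V P)" "\<And>V. V \<in> \<I> \<Longrightarrow> num_queries V P \<le> k"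
  shows "query_complexity n \<I> R \<le> enat k"
  unfolding query_complexity_def using assms
  by (intro INF_lower2[of P] SUP_least) auto

lemma query_complexity_ge:
  assumes "\<And>P k. legal n P \<Longrightarrow> (\<And>V. V \<in> \<I> \<Longrightarrow> R V (run V P)) \<Longrightarrow>
    (\<And>V. V \<in> \<I> \<Longrightarrow> num_queries V P \<le> k) \<Longrightarrow> l \<le> k"
  shows "enat l \<le> query_complexity n \<I> R"
  unfolding query_complexity_def
proof (rule INF_greatest)
  fix P assume P: "P \<in> {P. legal n P \<and> (\<forall>V\<in>\<I>. R V (run V P))}"
  show "enat l \<le> (SUP V\<in>\<I>. enat (num_queries V P))"
  proof (cases "SUP V\<in>\<I>. enat (num_queries V P)")
    case (enat k)
    have "num_queries V P \<le> k" if "V \<in> \<I>" for V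
      using SUP_upper[OF that, of "\<lambda>V. enat (num_queries V P)"] unfolding enat by simp
    then have "l \<le> k" using assms[of P k] P by blast
    then show ?thesis using enat by simp
  qed simp
qed

text \<open>One protocol serves all three problems; its output is post-processed at no cost.\<close>

lemma queries_upper:
  assumes n: "0 < n" and w: "w \<in> entitlements n"
  shows "decide_queries n w \<le> enat (n * 2 ^ n + 2 * n)"
    "compute_queries n w \<le> enat (n * 2 ^ n + 2 * n)"
    "compute_promise_queries n w \<le> enat (n * 2 ^ n + 2 * n)"
proof -
  have pos: "\<And>i. i < n \<Longrightarrow> 0 < w i" using w by (auto simp: entitlements_def)
  have legal: "legal n (csp_protocol n w)" by (rule legal_csp_protocol[OF n pos])
  have correct: "case run V (csp_protocol n w) of Some X \<Rightarrow> csp n w V X | None \<Rightarrow> \<not> (\<exists>X. csp n w V X)"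
    if "V \<in> profiles n" for V
    by (rule csp_protocol_correct[OF n pos that])
  note nq = num_queries_csp_protocol
  show "compute_queries n w \<le> enat (n * 2 ^ n + 2 * n)"
    unfolding compute_queries_def by (rule query_complexity_le[OF legal]) (rule correct nq | assumption)+
  have "run V (map_protocol (\<lambda>out. out \<noteq> None) (csp_protocol n w)) \<longleftrightarrow> (\<exists>X. csp n w V X)"
    if "V \<in> profiles n" for V
    using correct[OF that] by (auto simp: run_map split: option.splits)
  then show "decide_queries n w \<le> enat (n * 2 ^ n + 2 * n)"
    unfolding decide_queries_def using legal nq
    by (intro query_complexity_le[of _ "map_protocol (\<lambda>out. out \<noteq> None) (csp_protocol n w)"])
      (auto simp: legal_map num_queries_map)
  have "csp n w V (run V (map_protocol the (csp_protocol n w)))"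
    if "V \<in> profiles n" "\<exists>X. csp n w V X" for V
    using correct[OF that(1)] that(2) by (auto simp: run_map split: option.splits)
  then show "compute_promise_queries n w \<le> enat (n * 2 ^ n + 2 * n)"
    unfolding compute_promise_queries_def using legal nq
    by (intro query_complexity_le[of _ "map_protocol the (csp_protocol n w)"])
      (auto simp: legal_map num_queries_map)
qed

text \<open>The loss of \<open>m\<close> comes from the promise problem, where each piece can
  exploit two shifts. The other two bounds are weakened to share the formula.\<close>

lemma queries_lower:
  assumes m: "1 \<le> m"
  defines "n \<equiv> Suc m" and "l \<equiv> m * 2 ^ (m - 1) div 2 - m"
  shows "enat l \<le> decide_queries n (equal_entitlements n)"
    "enat l \<le> compute_queries n (equal_entitlements n)"
    "enat l \<le> compute_promise_queries n (equal_entitlements n)"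
proof -
  interpret hard_instance m using m by unfold_locales
  have l: "l \<le> k" if "m * 2 ^ (m - 1) \<le> 2 * k + 2 * m" for k
    using that unfolding l_def by linarith
  show "enat l \<le> decide_queries n (equal_entitlements n)"
    unfolding decide_queries_def n_def
  proof (rule query_complexity_ge)
    fix P k
    assume "legal (Suc m) P" "\<And>V. V \<in> profiles (Suc m) \<Longrightarrow> run V P = (\<exists>X. csp (Suc m) w V X)"
      "\<And>V. V \<in> profiles (Suc m) \<Longrightarrow> num_queries V P \<le> k"
    from decide_lower[OF this] show "l \<le> k" by (intro l) simp
  qed
  show "enat l \<le> compute_queries n (equal_entitlements n)"
    unfolding compute_queries_def n_def
  proof (rule query_complexity_ge)
    fix P :: "(nat \<Rightarrow> real set) option protocol" and k
    assume P: "legal (Suc m) P" and correct: "\<And>V. V \<in> profiles (Suc m) \<Longrightarrow>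
        case run V P of Some X \<Rightarrow> csp (Suc m) w V X | None \<Rightarrow> \<not> (\<exists>X. csp (Suc m) w V X)"
      and k: "\<And>V. V \<in> profiles (Suc m) \<Longrightarrow> num_queries V P \<le> k"
    have "m * 2 ^ (m - 1) \<le> 2 * k"
    proof (rule decide_lower)
      show "legal (Suc m) (map_protocol (\<lambda>out. out \<noteq> None) P)" using P by (simp add: legal_map)
      fix V assume V: "V \<in> profiles (Suc m)"
      show "run V (map_protocol (\<lambda>out. out \<noteq> None) P) \<longleftrightarrow> (\<exists>X. csp (Suc m) w V X)"
        using correct[OF V] by (auto simp: run_map split: option.splits)
      show "num_queries V (map_protocol (\<lambda>out. out \<noteq> None) P) \<le> k"
        using k[OF V] by (simp add: num_queries_map)
    qed
    then show "l \<le> k" by (intro l) simp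
  qed
  show "enat l \<le> compute_promise_queries n (equal_entitlements n)"
    unfolding compute_promise_queries_def n_def
  proof (rule query_complexity_ge)
    fix P k
    assume "legal (Suc m) P"
      "\<And>V. V \<in> {V \<in> profiles (Suc m). \<exists>X. csp (Suc m) w V X} \<Longrightarrow> csp (Suc m) w V (run V P)"
      "\<And>V. V \<in> {V \<in> profiles (Suc m). \<exists>X. csp (Suc m) w V X} \<Longrightarrow> num_queries V P \<le> k"
    then show "l \<le> k" by (intro l compute_promise_lower) auto
  qed
qed

lemma has_orderI:
  assumes upper: "\<And>n. 0 < n \<Longrightarrow> f n \<le> enat (n * 2 ^ n + 2 * n)"
    and lower: "\<And>m. 1 \<le> m \<Longrightarrow> enat (m * 2 ^ (m - 1) div 2 - m) \<le> f (Suc m)"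
  shows "has_order f (\<lambda>n. real n * 2 ^ n)"
proof -
  have fin: "\<exists>k. f n = enat k" if "0 < n" for n
    using upper[OF that] by (cases "f n") auto
  have up: "real (the_enat (f n)) \<le> 3 * (real n * 2 ^ n)" if n: "0 < n" for n
  proof -
    obtain k where k: "f n = enat k" using fin[OF n] by blast
    have "k \<le> n * 2 ^ n + 2 * n" using upper[OF n] k by simp
    also have "\<dots> \<le> 3 * (n * 2 ^ n)" by simp
    finally have "real k \<le> real (3 * (n * 2 ^ n))" by (rule of_nat_mono)
    then show ?thesis using k by simp
  qed
  \<comment> \<open>With \<open>s = n - 1\<close> and \<open>t = s * 2 ^ (n - 2)\<close>, the bound
    6 gives \<open>16 * s <= t\<close>, which outweighs the loss \<open>2 * s + 1\<close> and leaves
    at least \<open>t / 4\<close> queries. The factor 1/32 then follows from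
    \<open>n * 2 ^ n <= 8 * t\<close>.\<close>
  have lo: "1 / 32 * (real n * 2 ^ n) \<le> real (the_enat (f n))" if n: "6 \<le> n" for n
  proof -
    obtain m where m: "n = Suc (Suc m)" "4 \<le> m" using n by (cases n; cases "n - 1") auto
    obtain k where k: "f n = enat k" using fin[of n] n by auto
    have k_ge: "Suc m * 2 ^ m div 2 - Suc m \<le> k" using lower[of "Suc m"] k m by simp
    have "a \<le> 2 * k + 2 * b + 1" if "a div 2 - b \<le> k" for a b :: nat
      using that by linarith
    then have "real (Suc m * 2 ^ m) \<le> real (2 * k + 2 * Suc m + 1)"
      using k_ge by (intro of_nat_mono)
    define s t where "s = real (Suc m)" and "t = s * 2 ^ m"
    have "t \<le> 2 * real k + 2 * s + 1"
      using \<open>real (Suc m * 2 ^ m) \<le> _\<close> unfolding s_def t_def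
      by (simp only: of_nat_mult of_nat_add of_nat_power of_nat_numeral of_nat_1)
    moreover have "1 \<le> s" by (simp add: s_def)
    moreover have "s * 16 \<le> t"
      unfolding t_def using power_increasing[OF m(2), of "2::real"] \<open>1 \<le> s\<close>
      by (intro mult_left_mono) auto
    moreover have "real n * 2 ^ n \<le> 8 * t"
      using m(1) by (simp add: s_def t_def algebra_simps)
    ultimately have "1 / 32 * (real n * 2 ^ n) \<le> real k" by linarith
    then show ?thesis using k by simp
  qed
  have "eventually (\<lambda>n. f n \<noteq> \<infinity>) sequentially"
    using fin by (intro eventually_sequentiallyI[of 1]) force
  moreover have "(\<lambda>n. real (the_enat (f n))) \<in> O(\<lambda>n. real n * 2 ^ n)"
    using up by (intro bigoI[of _ 3] eventually_sequentiallyI[of 1]) auto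
  moreover have "(\<lambda>n. real (the_enat (f n))) \<in> \<Omega>(\<lambda>n. real n * 2 ^ n)"
    using lo by (intro landau_omega.bigI[of "1 / 32"] eventually_sequentiallyI[of 6]) auto
  ultimately show ?thesis unfolding has_order_def by (auto intro: bigthetaI)
qed

lemma equal_entitlements: "0 < n \<Longrightarrow> equal_entitlements n \<in> entitlements n"
  by (simp add: equal_entitlements_def entitlements_def)

theorem theorem10:
  shows "has_order (\<lambda>n. SUP w\<in>entitlements n. decide_queries n w) (\<lambda>n. real n * 2 ^ n)
    \<and> has_order (\<lambda>n. SUP w\<in>entitlements n. compute_queries n w) (\<lambda>n. real n * 2 ^ n)
    \<and> has_order (\<lambda>n. SUP w\<in>entitlements n. compute_promise_queries n w) (\<lambda>n. real n * 2 ^ n)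
    \<and> has_order (\<lambda>n. decide_queries n (equal_entitlements n)) (\<lambda>n. real n * 2 ^ n)
    \<and> has_order (\<lambda>n. compute_queries n (equal_entitlements n)) (\<lambda>n. real n * 2 ^ n)
    \<and> has_order (\<lambda>n. compute_promise_queries n (equal_entitlements n)) (\<lambda>n. real n * 2 ^ n)"
proof -
  \<comment> \<open>Equal entitlements are one candidate in the supremum, which thus inherits their
    lower bound; the upper bound holds for all entitlements.\<close>
  have eq: "equal_entitlements (Suc m) \<in> entitlements (Suc m)" for m
    by (simp add: equal_entitlements)
  show ?thesis
    by (intro conjI has_orderI SUP_least; (rule SUP_upper2[OF eq])?;
        rule queries_upper queries_lower; simp add: equal_entitlements)
qed

end
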